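(* Let $X$, $A$, $B$, $C$, $Y$, $G_+$, $G_-$ be as in the context. Then $G_+$ and $G_-$ are infinitesimal generators of strongly continuous semigroups $T_+:[0,\infty)\to L(Y,Y)$ and $T_-:[0,\infty)\to L(Y,Y)$, respectively. If $\mu_\pm\in\mathbb{R}$ are such that $\mathrm{Re}(\xi|G_\pm\xi)\geqslant-\mu_\pm(\xi|\xi)$ for all $\xi\in D(H)$, then the spectra of $G_+$ and $G_-$ are contained in $\{z\in\mathbb{C}:\mathrm{Re}\,z\geqslant-\mu_+\}$ and $\{z\in\mathbb{C}:\mathrm{Re}\,z\geqslant-\mu_-\}$, respectively, and $|T_+(t)|\leqslant\exp(\mu_+t)$, $|T_-(t)|\leqslant\exp(\mu_-t)$ for all $t\in[0,\infty)$.
   Context: $(X,\langle\cdot|\cdot\rangle)$ is a nontrivial complex Hilbert space with norm $\|\cdot\|$. $A:D(A)\to X$ is a densely defined self-adjoint linear operator with $\langle\xi|A\xi\rangle\geqslant\varepsilon\langle\xi|\xi\rangle$ for all $\xi\in D(A)$ for some $\varepsilon>0$; $A^{1/2}$ is its positive self-adjoint square root. $B:D(A^{1/2})\to X$ is linear with $\|B\xi\|^2\leqslant a^2\|A^{1/2}\xi\|^2+b^2\|\xi\|^2$ for all $\xi\in D(A^{1/2})$, for some $a\in[0,1)$, $b\in\mathbb{R}$, and $B$ is symmetric or bounded. $C:D(A^{1/2})\to X$ is linear with $\|C\xi\|^2\leqslant c^2\|A^{1/2}\xi\|^2+d^2\|\xi\|^2$ for all $\xi\in D(A^{1/2})$,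 for some real $c,d$. $Y:=D(A^{1/2})\times X$ with inner product $(\xi|\eta):=\langle A^{1/2}\xi_1|A^{1/2}\eta_1\rangle+\langle\xi_2|\eta_2\rangle$ and norm $|\cdot|$ (also used for operator norms on $Y$). $H:D(A)\times D(A^{1/2})\to Y$, $H\xi:=(-i\xi_2,iA\xi_1)$; $\hat B:D(H)\to Y$, $\hat B\xi:=(0,-B\xi_2)$; $V:Y\to Y$, $V\xi:=(0,iC\xi_1)$; $G_+:=-i(H+\hat B+V)$, $G_-:=i(H+\hat B+V)$ with domain $D(H)$. Convention: $G$ is the infinitesimal generator of the semigroup $S$ if $S(t)=e^{-tG}$, i.e. $\frac{d}{dt}S(t)\xi=-GS(t)\xi$ for $\xi\in D(G)$. *)

theory Defs
  imports "HOL-Analysis.Analysis"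
begin

text \<open>A complex Hilbert space is modelled on a type 'a with its additive group
structure (class ab_group_add), an explicit complex scalar multiplication smul
and an explicit inner product ip, linear in the second argument and conjugate
linear in the first (physicists' convention for the bracket notation).
All norms, limits, density and completeness are taken w.r.t. the norm
induced by ip.\<close>

definition hnorm :: "('a \<Rightarrow> 'a \<Rightarrow> complex) \<Rightarrow> 'a \<Rightarrow> real" where
  "hnorm ip x = sqrt (Re (ip x x))"

definition complex_hilbert ::
  "(complex \<Rightarrow> 'a::ab_group_add \<Rightarrow> 'a) \<Rightarrow> ('a \<Rightarrow> 'a \<Rightarrow> complex) \<Rightarrow> bool" where
  "complex_hilbert smul ip \<longleftrightarrow>
     (\<forall>a x y. smul a (x + y) = smul a x + smul a y) \<and>
     (\<forall>a b x. smul (a + b) x = smul a x + smul b x) \<and>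
     (\<forall>a b x. smul a (smul b x) = smul (a * b) x) \<and>
     (\<forall>x. smul 1 x = x) \<and>
     (\<forall>x y z. ip x (y + z) = ip x y + ip x z) \<and>
     (\<forall>a x y. ip x (smul a y) = a * ip x y) \<and>
     (\<forall>x y. ip y x = cnj (ip x y)) \<and>
     (\<forall>x. Re (ip x x) \<ge> 0) \<and>
     (\<forall>x. ip x x = 0 \<longrightarrow> x = 0) \<and>
     (\<forall>f :: nat \<Rightarrow> 'a.
        (\<forall>e>0. \<exists>N. \<forall>m\<ge>N. \<forall>n\<ge>N. hnorm ip (f m - f n) < e) \<longrightarrow>
        (\<exists>l. (\<lambda>n. hnorm ip (f n - l)) \<longlonglongrightarrow> 0))"

definition subspace_on :: "(complex \<Rightarrow> 'a::ab_group_add \<Rightarrow> 'a) \<Rightarrow> 'a set \<Rightarrow> bool" where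
  "subspace_on smul D \<longleftrightarrow> 0 \<in> D \<and> (\<forall>x\<in>D. \<forall>y\<in>D. x + y \<in> D) \<and> (\<forall>a. \<forall>x\<in>D. smul a x \<in> D)"

definition lin_on :: "(complex \<Rightarrow> 'a::ab_group_add \<Rightarrow> 'a) \<Rightarrow> (complex \<Rightarrow> 'b::ab_group_add \<Rightarrow> 'b)
    \<Rightarrow> 'a set \<Rightarrow> ('a \<Rightarrow> 'b) \<Rightarrow> bool" where
  "lin_on smul1 smul2 D f \<longleftrightarrow> subspace_on smul1 D \<and>
     (\<forall>x\<in>D. \<forall>y\<in>D. f (x + y) = f x + f y) \<and> (\<forall>a. \<forall>x\<in>D. f (smul1 a x) = smul2 a (f x))"

definition dense_in :: "('a::ab_group_add \<Rightarrow> 'a \<Rightarrow> complex) \<Rightarrow> 'a set \<Rightarrow> bool" where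
  "dense_in ip D \<longleftrightarrow> (\<forall>x. \<forall>e>0. \<exists>y\<in>D. hnorm ip (x - y) < e)"

definition self_adjoint :: "(complex \<Rightarrow> 'a::ab_group_add \<Rightarrow> 'a) \<Rightarrow> ('a \<Rightarrow> 'a \<Rightarrow> complex)
    \<Rightarrow> 'a set \<Rightarrow> ('a \<Rightarrow> 'a) \<Rightarrow> bool" where
  "self_adjoint smul ip D A \<longleftrightarrow> dense_in ip D \<and> lin_on smul smul D A \<and>
     (\<forall>y. y \<in> D \<longleftrightarrow> (\<exists>z. \<forall>x\<in>D. ip (A x) y = ip x z)) \<and>
     (\<forall>x\<in>D. \<forall>y\<in>D. ip (A x) y = ip x (A y))"

definition pos_sqrt :: "(complex \<Rightarrow> 'a::ab_group_add \<Rightarrow> 'a) \<Rightarrow> ('a \<Rightarrow> 'a \<Rightarrow> complex)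
    \<Rightarrow> 'a set \<Rightarrow> ('a \<Rightarrow> 'a) \<Rightarrow> 'a set \<Rightarrow> ('a \<Rightarrow> 'a) \<Rightarrow> bool" where
  "pos_sqrt smul ip DA A DS S \<longleftrightarrow> self_adjoint smul ip DS S \<and>
     (\<forall>x\<in>DS. Re (ip x (S x)) \<ge> 0) \<and>
     DA = {x \<in> DS. S x \<in> DS} \<and> (\<forall>x\<in>DA. S (S x) = A x)"

text \<open>The energy space Y = D(A^{1/2}) \<times> X.\<close>
definition psmul :: "(complex \<Rightarrow> 'a \<Rightarrow> 'a) \<Rightarrow> complex \<Rightarrow> 'a \<times> 'a \<Rightarrow> 'a \<times> 'a" where
  "psmul smul c y = (smul c (fst y), smul c (snd y))"

definition Yspace :: "'a set \<Rightarrow> ('a \<times> 'a) set" where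
  "Yspace DS = {y. fst y \<in> DS}"

definition yip :: "('a \<Rightarrow> 'a \<Rightarrow> complex) \<Rightarrow> ('a \<Rightarrow> 'a) \<Rightarrow> 'a \<times> 'a \<Rightarrow> 'a \<times> 'a \<Rightarrow> complex" where
  "yip ip S x y = ip (S (fst x)) (S (fst y)) + ip (snd x) (snd y)"

definition ynorm :: "('a \<Rightarrow> 'a \<Rightarrow> complex) \<Rightarrow> ('a \<Rightarrow> 'a) \<Rightarrow> 'a \<times> 'a \<Rightarrow> real" where
  "ynorm ip S y = sqrt (Re (yip ip S y y))"

definition DH :: "'a set \<Rightarrow> 'a set \<Rightarrow> ('a \<times> 'a) set" where
  "DH DA DS = {y. fst y \<in> DA \<and> snd y \<in> DS}"

definition Hop :: "(complex \<Rightarrow> 'a \<Rightarrow> 'a) \<Rightarrow> ('a \<Rightarrow> 'a) \<Rightarrow> 'a \<times> 'a \<Rightarrow> 'a \<times> 'a" where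
  "Hop smul A y = (smul (- \<i>) (snd y), smul \<i> (A (fst y)))"

definition Bhat :: "('a \<Rightarrow> 'a::ab_group_add) \<Rightarrow> 'a \<times> 'a \<Rightarrow> 'a \<times> 'a" where
  "Bhat B y = (0, - B (snd y))"

definition Vop :: "(complex \<Rightarrow> 'a::ab_group_add \<Rightarrow> 'a) \<Rightarrow> ('a \<Rightarrow> 'a) \<Rightarrow> 'a \<times> 'a \<Rightarrow> 'a \<times> 'a" where
  "Vop smul C y = (0, smul \<i> (C (fst y)))"

definition Gplus :: "(complex \<Rightarrow> 'a::ab_group_add \<Rightarrow> 'a) \<Rightarrow> ('a \<Rightarrow> 'a) \<Rightarrow> ('a \<Rightarrow> 'a) \<Rightarrow> ('a \<Rightarrow> 'a)
    \<Rightarrow> 'a \<times> 'a \<Rightarrow> 'a \<times> 'a" where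
  "Gplus smul A B C y = psmul smul (- \<i>) (Hop smul A y + Bhat B y + Vop smul C y)"

definition Gminus :: "(complex \<Rightarrow> 'a::ab_group_add \<Rightarrow> 'a) \<Rightarrow> ('a \<Rightarrow> 'a) \<Rightarrow> ('a \<Rightarrow> 'a) \<Rightarrow> ('a \<Rightarrow> 'a)
    \<Rightarrow> 'a \<times> 'a \<Rightarrow> 'a \<times> 'a" where
  "Gminus smul A B C y = psmul smul \<i> (Hop smul A y + Bhat B y + Vop smul C y)"

text \<open>Strongly continuous semigroup of bounded linear operators on Y
(the values of T t outside Y are irrelevant).\<close>
definition sc_semigroup :: "(complex \<Rightarrow> 'a::ab_group_add \<Rightarrow> 'a) \<Rightarrow> ('a \<Rightarrow> 'a \<Rightarrow> complex)
    \<Rightarrow> 'a set \<Rightarrow> ('a \<Rightarrow> 'a) \<Rightarrow> (real \<Rightarrow> 'a \<times> 'a \<Rightarrow> 'a \<times> 'a) \<Rightarrow> bool" where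
  "sc_semigroup smul ip DS S T \<longleftrightarrow>
     (\<forall>t\<ge>0. \<forall>y\<in>Yspace DS. T t y \<in> Yspace DS) \<and>
     (\<forall>t\<ge>0. lin_on (psmul smul) (psmul smul) (Yspace DS) (T t)) \<and>
     (\<forall>t\<ge>0. \<exists>K. \<forall>y\<in>Yspace DS. ynorm ip S (T t y) \<le> K * ynorm ip S y) \<and>
     (\<forall>y\<in>Yspace DS. T 0 y = y) \<and>
     (\<forall>s\<ge>0. \<forall>t\<ge>0. \<forall>y\<in>Yspace DS. T (s + t) y = T s (T t y)) \<and>
     (\<forall>y\<in>Yspace DS. \<forall>t0\<ge>0.
        ((\<lambda>t. ynorm ip S (T t y - T t0 y)) \<longlongrightarrow> 0) (at t0 within {0..}))"

text \<open>G with domain D is the infinitesimal generator of T, with the convention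
T(t) = exp(-tG): D(G) = {y. lim_{h\<rightarrow>0+} (T h y - y)/h exists in Y} and
G y = - lim_{h\<rightarrow>0+} (T h y - y)/h.\<close>
definition is_generator :: "(complex \<Rightarrow> 'a::ab_group_add \<Rightarrow> 'a) \<Rightarrow> ('a \<Rightarrow> 'a \<Rightarrow> complex)
    \<Rightarrow> 'a set \<Rightarrow> ('a \<Rightarrow> 'a) \<Rightarrow> (real \<Rightarrow> 'a \<times> 'a \<Rightarrow> 'a \<times> 'a)
    \<Rightarrow> ('a \<times> 'a) set \<Rightarrow> ('a \<times> 'a \<Rightarrow> 'a \<times> 'a) \<Rightarrow> bool" where
  "is_generator smul ip DS S T D G \<longleftrightarrow>
     D \<subseteq> Yspace DS \<and>
     (\<forall>y\<in>Yspace DS. y \<in> D \<longleftrightarrow> (\<exists>z\<in>Yspace DS.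
        ((\<lambda>h. ynorm ip S (psmul smul (complex_of_real (1 / h)) (T h y - y) - z)) \<longlongrightarrow> 0)
          (at_right 0))) \<and>
     (\<forall>y\<in>D. G y \<in> Yspace DS \<and>
        ((\<lambda>h. ynorm ip S (psmul smul (complex_of_real (1 / h)) (T h y - y) + G y)) \<longlongrightarrow> 0)
          (at_right 0))"

definition in_resolvent :: "(complex \<Rightarrow> 'a::ab_group_add \<Rightarrow> 'a) \<Rightarrow> ('a \<Rightarrow> 'a \<Rightarrow> complex)
    \<Rightarrow> 'a set \<Rightarrow> ('a \<Rightarrow> 'a) \<Rightarrow> ('a \<times> 'a) set \<Rightarrow> ('a \<times> 'a \<Rightarrow> 'a \<times> 'a) \<Rightarrow> complex \<Rightarrow> bool" where
  "in_resolvent smul ip DS S D G z \<longleftrightarrow>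
     (\<forall>w\<in>Yspace DS. \<exists>!x. x \<in> D \<and> psmul smul z x - G x = w) \<and>
     (\<exists>K. \<forall>x\<in>D. ynorm ip S x \<le> K * ynorm ip S (psmul smul z x - G x))"

definition op_spectrum :: "(complex \<Rightarrow> 'a::ab_group_add \<Rightarrow> 'a) \<Rightarrow> ('a \<Rightarrow> 'a \<Rightarrow> complex)
    \<Rightarrow> 'a set \<Rightarrow> ('a \<Rightarrow> 'a) \<Rightarrow> ('a \<times> 'a) set \<Rightarrow> ('a \<times> 'a \<Rightarrow> 'a \<times> 'a) \<Rightarrow> complex set" where
  "op_spectrum smul ip DS S D G = {z. \<not> in_resolvent smul ip DS S D G z}"

end

theory Submission
  imports Defs
begin

text \<open>
  Since A has a positive lower bound, its square root S is a bijection from D(S) onto X, so that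
  (x, y) \<mapsto> (S x, y) is a unitary map from the energy space Y onto X \<times> X. The sign
  \<plusminus> does not matter for the estimates: the real part of (x|Gx) only sees Im (y|By), which is
  controlled if B is symmetric or bounded, and (y|Cx), so both operators are quasi-accretive. Eliminating
  the second component reduces surjectivity of l + G, for large real l, to that of
  A + l^2 \<plusminus> i l B + C, and (\<plusminus> i l B + C)(A + l^2)^{-1} has norm at most 17/20.

  Generation is then the Lumer-Phillips theorem. With J h = (1 + hG)^{-1}, the identity
  (1 + sG)(1 + tG) - (1 + (s + t)G) = st GG shows that J (s + t) and J s J t differ by at most
  st |GGx| at x. As the resolvents are commuting contractions, telescoping the 2^n-th powers makes the
  dyadic sequence J (t / 2^n)^(2^n) x Cauchy at a geometric rate, and the same estimate gives the
  semigroup law and the generator without any integration. The norm bounds are those of the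
  powers of J, and the spectral bound takes one Neumann step from a large real point.
\<close>

section \<open>Complex Hilbert spaces\<close>

text \<open>The energy space is only a subset of its type, because first components must lie in
  \<open>DS\<close>. Passing to the full product lets the semigroup theory be developed for a
  Hilbert space that fills its type, with a domain needed only for the generator. The growth and
  spectral claims concern every admissible \<mu>, whereas the semigroup is built from one fixed
  shift. For this reason the lower bounds and the estimates of resolvents and semigroups carry a
  free constant instead of the shift itself. The resolvent defect contains G G x, which makes sense
  only if x and G x lie in the domain. Hence vectors of this kind must be dense, even in the graph
  norm when the derivative is computed; contractivity then carries the estimates to other vectors.
  The number 17/20 is 3/4 + 1/10. In the square of the norm of (A + l^2) x the cross term is 2 l^2
  times the square of the norm of S x, and its factor 2 is what leaves room for l B.\<close>

locale chilbert =
  fixes sm :: "complex \<Rightarrow> 'a::ab_group_add \<Rightarrow> 'a" and ip :: "'a \<Rightarrow> 'a \<Rightarrow> complex"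
  assumes hilb: "complex_hilbert sm ip"
begin

sublocale vector_space sm
proof -
  note h = hilb[unfolded complex_hilbert_def]
  note h1 = conjunct1[OF h] and h = conjunct2[OF h]
  note h2 = conjunct1[OF h] and h = conjunct2[OF h]
  note h3 = conjunct1[OF h] and h = conjunct2[OF h]
  note h4 = conjunct1[OF h]
  show "vector_space sm"
    using h1 h2 h3 h4 by unfold_locales blast+
qed

abbreviation nm :: "'a \<Rightarrow> real" where "nm \<equiv> hnorm ip"

text \<open>The type carries no topology, so convergence is expressed through norm distances. The
  arbitrary filter covers sequences, continuity in time and one-sided difference quotients
  alike.\<close>

definition tends :: "('i \<Rightarrow> 'a) \<Rightarrow> 'a \<Rightarrow> 'i filter \<Rightarrow> bool" where
  "tends f l F \<longleftrightarrow> ((\<lambda>i. nm (f i - l)) \<longlongrightarrow> 0) F"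

lemma ip_add_right: "ip x (y + z) = ip x y + ip x z"
  and ip_scale_right: "ip x (sm c y) = c * ip x y"
  and ip_cnj: "ip y x = cnj (ip x y)"
  and ip_self_nonneg: "Re (ip x x) \<ge> 0"
  and ip_self_eq_0: "ip x x = 0 \<Longrightarrow> x = 0"
proof -
  note h = hilb[unfolded complex_hilbert_def]
  note h = conjunct2[OF conjunct2[OF conjunct2[OF conjunct2[OF h]]]]
  note h1 = conjunct1[OF h] and h = conjunct2[OF h]
  note h2 = conjunct1[OF h] and h = conjunct2[OF h]
  note h3 = conjunct1[OF h] and h = conjunct2[OF h]
  note h4 = conjunct1[OF h] and h = conjunct2[OF h]
  note h5 = conjunct1[OF h]
  show "ip x (y + z) = ip x y + ip x z" using h1 by blast
  show "ip x (sm c y) = c * ip x y" using h2 by blast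
  show "ip y x = cnj (ip x y)" using h3 by blast
  show "Re (ip x x) \<ge> 0" using h4 by blast
  show "ip x x = 0 \<Longrightarrow> x = 0" using h5 by blast
qed

lemma ip_add_left: "ip (x + y) z = ip x z + ip y z"
  using ip_add_right[of z x y] by (simp add: ip_cnj[of _ z])

lemma ip_scale_left: "ip (sm c x) y = cnj c * ip x y"
  using ip_scale_right[of y c x] by (simp add: ip_cnj[of _ y])

lemma ip_zero_right [simp]: "ip x 0 = 0"
  using ip_scale_right[of x 0 0] by simp

lemma ip_zero_left [simp]: "ip 0 x = 0"
  by (simp add: ip_cnj[of 0 x])

lemma ip_minus_right: "ip x (- y) = - ip x y"
  using ip_add_right[of x y "- y"] by (simp add: add_eq_0_iff)

lemma ip_minus_left: "ip (- x) y = - ip x y"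
  using ip_minus_right[of y x] by (simp add: ip_cnj[of _ y])

lemma ip_diff_right: "ip x (y - z) = ip x y - ip x z"
  using ip_add_right[of x y "- z"] by (simp add: ip_minus_right)

lemma ip_diff_left: "ip (x - y) z = ip x z - ip y z"
  using ip_add_left[of x "- y" z] by (simp add: ip_minus_left)

lemmas ip_simps = ip_add_right ip_add_left ip_scale_right ip_scale_left ip_minus_right
  ip_minus_left ip_diff_right ip_diff_left

lemma nm_nonneg [simp]: "0 \<le> nm x"
  by (simp add: hnorm_def ip_self_nonneg)

lemma nm_square: "(nm x)\<^sup>2 = Re (ip x x)"
  by (simp add: hnorm_def ip_self_nonneg)

lemma ip_self: "ip x x = complex_of_real ((nm x)\<^sup>2)"
proof -
  have "Im (ip x x) = 0"
    using arg_cong[OF ip_cnj[of x x], of Im] by simp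
  then show ?thesis by (simp add: complex_eq_iff nm_square)
qed

lemma nm_eq_0_iff [simp]: "nm x = 0 \<longleftrightarrow> x = 0"
proof
  assume "nm x = 0"
  then show "x = 0" using ip_self[of x] by (intro ip_self_eq_0) simp
qed (simp add: hnorm_def)

lemma nm_zero [simp]: "nm 0 = 0"
  by simp

lemma nm_scale: "nm (sm c x) = cmod c * nm x"
proof -
  have "(nm (sm c x))\<^sup>2 = Re ((c * cnj c) * ip x x)"
    by (simp add: nm_square ip_simps mult_ac)
  also have "\<dots> = (cmod c * nm x)\<^sup>2"
    by (simp add: complex_norm_square[symmetric] ip_self power_mult_distrib del: of_real_power of_real_mult flip: of_real_power of_real_mult)
  finally show ?thesis
    by (simp add: power2_eq_iff_nonneg)
qed

lemma nm_minus [simp]: "nm (- x) = nm x"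
  by (simp add: hnorm_def ip_simps)

lemma nm_minus_commute: "nm (x - y) = nm (y - x)"
  by (metis nm_minus minus_diff_eq)

lemma Cauchy_Schwarz: "cmod (ip x y) \<le> nm x * nm y"
proof (cases "x = 0")
  case False
  define n where "n = (nm x)\<^sup>2"
  have n: "n > 0" using False by (simp add: n_def)
  \<comment> \<open>\<open>sm c x\<close> is the orthogonal projection of \<open>y\<close> onto the
    line through \<open>x\<close>; the inequality is the nonnegativity of the squared
    residual.\<close>
  define c where "c = ip x y / of_real n"
  define r where "r = (cmod (ip x y))\<^sup>2"
  have yx: "ip y x = cnj (ip x y)" by (rule ip_cnj)
  have m: "ip x y * cnj (ip x y) = of_real r"
    by (simp add: r_def complex_norm_square[symmetric] flip: of_real_power)
  have "0 \<le> Re (ip (y - sm c x) (y - sm c x))" by (rule ip_self_nonneg)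
  also have "ip (y - sm c x) (y - sm c x) = ip y y - c * cnj (ip x y) - cnj c * ip x y + c * cnj c * ip x x"
    by (simp add: ip_simps yx algebra_simps)
  also have "\<dots> = of_real ((nm y)\<^sup>2) - of_real (r / n)"
  proof -
    have "c * cnj (ip x y) = of_real (r / n)"
      by (simp add: c_def m)
    moreover have "cnj c * ip x y = of_real (r / n)"
      by (simp add: c_def mult.commute[of "cnj _"] m)
    moreover have "c * cnj c * ip x x = of_real (r / n)"
    proof -
      have "c * cnj c * ip x x = (ip x y * cnj (ip x y)) / (of_real n * of_real n) * of_real n"
        by (simp add: c_def ip_self n_def)
      then show ?thesis using n by (simp add: m)
    qed
    ultimately show ?thesis by (simp add: ip_self)
  qed
  finally have "r / n \<le> (nm y)\<^sup>2" by simp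
  then have "r \<le> (nm x * nm y)\<^sup>2"
    using n by (simp add: n_def field_simps power_mult_distrib)
  then show ?thesis by (simp add: r_def power2_le_iff_abs_le)
qed simp

lemma nm_add_square: "(nm (x + y))\<^sup>2 = (nm x)\<^sup>2 + 2 * Re (ip x y) + (nm y)\<^sup>2"
proof -
  have "Re (ip y x) = Re (ip x y)" using arg_cong[OF ip_cnj[of y x], of Re] by simp
  then show ?thesis by (simp add: nm_square ip_simps)
qed

lemma nm_triangle: "nm (x + y) \<le> nm x + nm y"
proof -
  have "(nm (x + y))\<^sup>2 \<le> (nm x + nm y)\<^sup>2"
    using Cauchy_Schwarz[of x y] complex_Re_le_cmod[of "ip x y"] by (simp add: nm_add_square power2_sum)
  then show ?thesis by (rule power2_le_imp_le) simp
qed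

lemma nm_triangle_sub: "nm (x - z) \<le> nm (x - y) + nm (y - z)"
  using nm_triangle[of "x - y" "y - z"] by simp

lemma nm_triangle_minus: "nm (x - y) \<le> nm x + nm y"
  using nm_triangle[of x "- y"] by simp

lemma parallelogram: "(nm (x + y))\<^sup>2 + (nm (x - y))\<^sup>2 = 2 * (nm x)\<^sup>2 + 2 * (nm y)\<^sup>2"
  by (simp add: nm_square ip_simps)

section \<open>Completeness and convergence in the norm of the inner product\<close>

lemma complete:
  fixes f :: "nat \<Rightarrow> 'a"
  assumes "\<And>e. e > 0 \<Longrightarrow> \<exists>N. \<forall>m\<ge>N. \<forall>n\<ge>N. nm (f m - f n) < e"
  shows "\<exists>l. tends f l sequentially"
proof -
  note h = hilb[unfolded complex_hilbert_def]
  note h = conjunct2[OF conjunct2[OF conjunct2[OF conjunct2[OF h]]]]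
  note h = conjunct2[OF conjunct2[OF conjunct2[OF conjunct2[OF conjunct2[OF h]]]]]
  show ?thesis unfolding tends_def by (rule h[rule_format, OF assms])
qed

lemma tends_bound:
  assumes "(g \<longlongrightarrow> 0) F" "eventually (\<lambda>i. nm (f i - l) \<le> g i) F"
  shows "tends f l F"
  unfolding tends_def by (rule tendsto_sandwich[OF _ assms(2) tendsto_const assms(1)]) simp

lemma tends_const [simp]: "tends (\<lambda>_. l) l F"
  by (simp add: tends_def)

lemma tends_add:
  assumes "tends f l F" "tends g m F"
  shows "tends (\<lambda>i. f i + g i) (l + m) F"
proof (rule tends_bound)
  show "((\<lambda>i. nm (f i - l) + nm (g i - m)) \<longlongrightarrow> 0) F"
    using tendsto_add[OF assms[unfolded tends_def]] by simp
  show "eventually (\<lambda>i. nm (f i + g i - (l + m)) \<le> nm (f i - l) + nm (g i - m)) F"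
    using nm_triangle by (intro always_eventually allI) (metis add_diff_add)
qed

lemma tends_scale:
  assumes "(c \<longlongrightarrow> k) F" "tends f l F"
  shows "tends (\<lambda>i. sm (c i) (f i)) (sm k l) F"
proof (rule tends_bound)
  have "((\<lambda>i. cmod (c i) * nm (f i - l) + cmod (c i - k) * nm l) \<longlongrightarrow> cmod k * 0 + cmod (k - k) * nm l) F"
    using assms(2) unfolding tends_def by (intro tendsto_intros assms(1))
  then show "((\<lambda>i. cmod (c i) * nm (f i - l) + cmod (c i - k) * nm l) \<longlongrightarrow> 0) F" by simp
  have "nm (sm (c i) (f i) - sm k l) \<le> cmod (c i) * nm (f i - l) + cmod (c i - k) * nm l" for i
  proof -
    have "sm (c i) (f i) - sm k l = sm (c i) (f i - l) + sm (c i - k) l"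
      by (simp add: scale_left_diff_distrib scale_right_diff_distrib)
    then show ?thesis using nm_triangle by (metis nm_scale)
  qed
  then show "eventually (\<lambda>i. nm (sm (c i) (f i) - sm k l) \<le> cmod (c i) * nm (f i - l) + cmod (c i - k) * nm l) F"
    by simp
qed

lemma tends_minus: "tends f l F \<Longrightarrow> tends (\<lambda>i. - f i) (- l) F"
  unfolding tends_def by (simp add: nm_minus_commute)

lemma tends_diff:
  "tends f l F \<Longrightarrow> tends g m F \<Longrightarrow> tends (\<lambda>i. f i - g i) (l - m) F"
  using tends_add[OF _ tends_minus] by fastforce

lemma tends_nm:
  assumes "tends f l F" shows "((\<lambda>i. nm (f i)) \<longlongrightarrow> nm l) F"
proof (rule Lim_transform2)
  show "((\<lambda>_. nm l) \<longlongrightarrow> nm l) F" by simp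
  show "((\<lambda>i. nm l - nm (f i)) \<longlongrightarrow> 0) F"
  proof (rule tendsto_rabs_zero_cancel, rule tendsto_sandwich[OF _ _ tendsto_const])
    show "((\<lambda>i. nm (f i - l)) \<longlongrightarrow> 0) F" using assms by (simp add: tends_def)
    have "\<bar>nm l - nm (f i)\<bar> \<le> nm (f i - l)" for i
      using nm_triangle[of "f i - l" l] nm_triangle[of "l - f i" "f i"] nm_minus_commute[of l "f i"] by simp
    then show "eventually (\<lambda>i. \<bar>nm l - nm (f i)\<bar> \<le> nm (f i - l)) F" by simp
  qed simp
qed

lemma tends_unique:
  assumes "F \<noteq> bot" "tends f l F" "tends f m F"
  shows "l = m"
proof -
  have "tends (\<lambda>i. f i - f i) (l - m) F" by (intro tends_diff assms)
  from tends_nm[OF this] have "((\<lambda>i. 0::real) \<longlongrightarrow> nm (l - m)) F" by simp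
  then have "nm (l - m) = 0" using assms(1) tendsto_unique tendsto_const by metis
  then show ?thesis by simp
qed

lemma tends_ip_right:
  assumes "tends f l F" shows "((\<lambda>i. ip x (f i)) \<longlongrightarrow> ip x l) F"
proof (rule Lim_transform2[OF tendsto_const], rule tendsto_norm_zero_cancel,
    rule tendsto_sandwich[OF _ _ tendsto_const])
  show "((\<lambda>i. nm x * nm (f i - l)) \<longlongrightarrow> 0) F"
    using tendsto_mult_left[OF assms[unfolded tends_def], of "nm x"] by simp
  show "eventually (\<lambda>i. cmod (ip x l - ip x (f i)) \<le> nm x * nm (f i - l)) F"
    using Cauchy_Schwarz nm_minus_commute by (intro always_eventually) (metis ip_diff_right)
qed simp

text \<open>For an element x of the dense set closer to y than \<open>nm y\<close>, orthogonality
  gives |y|^2 = Re <y - x|y> < |y|^2 unless y vanishes.\<close>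

lemma dense_orthogonal_imp_zero:
  assumes "dense_in ip D" "\<And>x. x \<in> D \<Longrightarrow> ip x y = 0"
  shows "y = 0"
proof (rule ccontr)
  assume "y \<noteq> 0"
  then have p: "nm y > 0" using nm_nonneg[of y] nm_eq_0_iff[of y] by linarith
  then obtain x where x: "x \<in> D" "nm (y - x) < nm y"
    using assms(1) unfolding dense_in_def by blast
  have "(nm y)\<^sup>2 = Re (ip (y - x) y)"
    by (simp add: nm_square ip_simps assms(2) x(1))
  also have "\<dots> \<le> nm (y - x) * nm y"
    using complex_Re_le_cmod Cauchy_Schwarz order_trans by blast
  also have "\<dots> < nm y * nm y" using x(2) p by simp
  finally show False by (simp add: power2_eq_square)
qed

text \<open>The partial sums of the Neumann series, as the Picard iteration of x = y - P x.\<close>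

lemma perturbed_identity_surj:
  assumes P: "\<And>x y. P (x - y) = P x - P y" and bd: "\<And>x. nm (P x) \<le> q * nm x" and q: "0 \<le> q" "q < 1"
  shows "\<exists>x. x + P x = y"
proof -
  define f where "f = rec_nat (0::'a) (\<lambda>_ x. y - P x)"
  have f: "f 0 = 0" "f (Suc n) = y - P (f n)" for n by (simp_all add: f_def)
  have step: "nm (f (Suc n) - f n) \<le> q ^ n * nm y" for n
  proof (induction n)
    case 0 then show ?case using P[of 0 0] by (simp add: f)
  next
    case (Suc n)
    have "f (Suc (Suc n)) - f (Suc n) = P (f n - f (Suc n))"
      by (simp add: f(2)[of "Suc n"] P) (simp add: f(2)[of n])
    then have "nm (f (Suc (Suc n)) - f (Suc n)) \<le> q * nm (f n - f (Suc n))"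
      using bd by simp
    also have "\<dots> = q * nm (f (Suc n) - f n)" by (simp only: nm_minus_commute)
    also have "\<dots> \<le> q * (q ^ n * nm y)" using Suc q by (intro mult_left_mono) auto
    finally show ?case by (simp add: mult_ac)
  qed
  \<comment> \<open>The factor is the geometric sum q^m + ... + q^(m+k-1) in closed form, so that
    the induction on \<open>k\<close> is exact.\<close>
  have tail: "nm (f (m + k) - f m) \<le> q ^ m * (1 - q ^ k) / (1 - q) * nm y" for m k
  proof (induction k)
    case (Suc k)
    have "nm (f (m + Suc k) - f m) \<le> nm (f (Suc (m + k)) - f (m + k)) + nm (f (m + k) - f m)"
      using nm_triangle_sub by simp
    also have "\<dots> \<le> q ^ (m + k) * nm y + q ^ m * (1 - q ^ k) / (1 - q) * nm y"
      by (intro add_mono step Suc)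
    also have "\<dots> = q ^ m * (1 - q ^ Suc k) / (1 - q) * nm y"
    proof -
      have "q ^ (m + k) + q ^ m * (1 - q ^ k) / (1 - q) = q ^ m * (1 - q ^ Suc k) / (1 - q)"
        using q by (simp add: field_simps power_add)
      then show ?thesis by (metis distrib_right)
    qed
    finally show ?case .
  qed simp
  have tail': "nm (f n - f m) \<le> q ^ m / (1 - q) * nm y" if nm: "m \<le> n" for n m
  proof -
    obtain k where k: "n = m + k" using le_Suc_ex[OF nm] by auto
    have "q ^ m * (1 - q ^ k) \<le> q ^ m"
      using q by (simp add: mult_left_le)
    then have "q ^ m * (1 - q ^ k) / (1 - q) * nm y \<le> q ^ m / (1 - q) * nm y"
      using q by (intro mult_right_mono divide_right_mono) simp_all
    then show ?thesis using tail[of m k] unfolding k by (rule order_trans[rotated])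
  qed
  have "\<exists>l. tends f l sequentially"
  proof (rule complete)
    fix e :: real assume e: "e > 0"
    have "(\<lambda>m. q ^ m / (1 - q) * nm y) \<longlonglongrightarrow> 0 / (1 - q) * nm y"
      using q by (intro tendsto_intros LIMSEQ_power_zero) auto
    then have "eventually (\<lambda>m. q ^ m / (1 - q) * nm y < e) sequentially"
      by (rule order_tendstoD(2)) (simp add: e)
    then obtain N where N: "\<And>m. m \<ge> N \<Longrightarrow> q ^ m / (1 - q) * nm y < e"
      unfolding eventually_sequentially by blast
    have "nm (f m - f n) < e" if "m \<ge> N" "n \<ge> N" for m n
    proof (cases "m \<le> n")
      case True
      then have "nm (f n - f m) < e" using tail'[OF True] N[OF that(1)] by linarith
      then show ?thesis by (simp only: nm_minus_commute)
    next
      case False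
      then have "nm (f m - f n) \<le> q ^ n / (1 - q) * nm y" by (intro tail') simp
      then show ?thesis using N[OF that(2)] by linarith
    qed
    then show "\<exists>N. \<forall>m\<ge>N. \<forall>n\<ge>N. nm (f m - f n) < e" by blast
  qed
  then obtain l where l: "tends f l sequentially" by blast
  have "tends (\<lambda>n. f (Suc n)) l sequentially"
    using l unfolding tends_def by (rule LIMSEQ_Suc)
  moreover have "tends (\<lambda>n. f (Suc n)) (y - P l) sequentially"
  proof -
    have "tends (\<lambda>n. P (f n)) (P l) sequentially"
    proof (rule tends_bound)
      show "(\<lambda>n. q * nm (f n - l)) \<longlonglongrightarrow> 0"
        using l unfolding tends_def by (rule tendsto_mult_right_zero)
      show "eventually (\<lambda>n. nm (P (f n) - P l) \<le> q * nm (f n - l)) sequentially"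
        by (intro always_eventually allI) (metis bd P)
    qed
    then show ?thesis unfolding f by (intro tends_diff tends_const)
  qed
  ultimately have "l = y - P l" by (rule tends_unique[OF sequentially_bot])
  then have "l + P l = y" by (simp add: eq_diff_eq)
  then show ?thesis by blast
qed

text \<open>In the unknown v = M x the equation reads v + P (Q v) = y for a right inverse
  \<open>Q\<close> of \<open>M\<close>, and P Q has norm at most q < 1.\<close>

lemma relatively_bounded_perturbation_surj:
  assumes D: "\<And>x y. x \<in> D \<Longrightarrow> y \<in> D \<Longrightarrow> x - y \<in> D"
    and M: "\<And>x y. x \<in> D \<Longrightarrow> y \<in> D \<Longrightarrow> M (x - y) = M x - M y" "\<And>y. \<exists>x\<in>D. M x = y"
    and P: "\<And>x y. x \<in> D \<Longrightarrow> y \<in> D \<Longrightarrow> P (x - y) = P x - P y"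
      "\<And>x. x \<in> D \<Longrightarrow> nm (P x) \<le> q * nm (M x)"
    and q: "0 \<le> q" "q < 1"
  shows "\<exists>x\<in>D. M x + P x = y"
proof -
  obtain Q where Q: "\<And>v. Q v \<in> D" "\<And>v. M (Q v) = v" using M(2) by metis
  \<comment> \<open>\<open>Q\<close> is picked pointwise and need not be linear. Its additivity
    defect lies in the kernel of \<open>M\<close>, where the relative bound forces \<open>P\<close>
    to vanish, so P Q is additive all the same.\<close>
  have "P (Q (u - v)) = P (Q u) - P (Q v)" for u v
  proof -
    define e where "e = Q (u - v) - (Q u - Q v)"
    have "M e = 0" by (simp only: e_def M D Q) simp
    moreover have "e \<in> D" by (simp only: e_def D Q)
    ultimately have "nm (P e) \<le> 0" using P(2)[of e] by simp
    then have "P e = 0" using nm_nonneg[of "P e"] by simp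
    moreover have "P e = P (Q (u - v)) - (P (Q u) - P (Q v))" by (simp only: e_def P D Q)
    ultimately show ?thesis by simp
  qed
  moreover have "nm (P (Q v)) \<le> q * nm v" for v using P(2)[OF Q(1)[of v]] by (simp only: Q)
  ultimately have "\<exists>v. v + P (Q v) = y" using q by (rule perturbed_identity_surj)
  then show ?thesis using Q by metis
qed

end

section \<open>Resolvents of m-accretive operators\<close>

context chilbert begin

lemma nm_scale_real: "nm (sm (complex_of_real r) x) = \<bar>r\<bar> * nm x"
  by (simp add: nm_scale)

lemma funpow_commute:
  assumes "\<And>x. P (Q x) = Q (P x)"
  shows "(P ^^ n) (Q x) = Q ((P ^^ n) x)"
  by (induction n) (simp_all add: assms)

lemma funpow_diff:
  fixes P :: "'a \<Rightarrow> 'a"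
  assumes "\<And>x y. P (x - y) = P x - P y"
  shows "(P ^^ n) (x - y) = (P ^^ n) x - (P ^^ n) y"
  by (induction n) (simp_all add: assms)

lemma funpow_nm_le:
  assumes "\<And>x. nm (P x) \<le> nm x"
  shows "nm ((P ^^ n) x) \<le> nm x"
  by (induction n) (auto intro: order_trans[OF assms])

text \<open>Commuting brings the difference P - Q directly onto \<open>x\<close> in each telescoping
  term, and contractivity discards the other factors. The one-step error is thus needed at
  \<open>x\<close> only, not along the orbit.\<close>

lemma funpow_diff_bound:
  assumes comm: "\<And>x. P (Q x) = Q (P x)"
    and P: "\<And>x y. P (x - y) = P x - P y" "\<And>x. nm (P x) \<le> nm x"
    and Q: "\<And>x y. Q (x - y) = Q x - Q y" "\<And>x. nm (Q x) \<le> nm x"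
  shows "nm ((P ^^ n) x - (Q ^^ n) x) \<le> real n * nm (P x - Q x)"
proof (induction n)
  case (Suc n)
  have "(P ^^ Suc n) x - (Q ^^ Suc n) x = (P ^^ n) (P x - Q x) + Q ((P ^^ n) x - (Q ^^ n) x)"
    by (simp add: funpow_diff[of P, OF P(1)] funpow_commute[of P Q, OF comm] Q(1)
        funpow_commute[of P P, OF refl])
  then have "nm ((P ^^ Suc n) x - (Q ^^ Suc n) x) \<le> nm ((P ^^ n) (P x - Q x)) + nm (Q ((P ^^ n) x - (Q ^^ n) x))"
    using nm_triangle by simp
  also have "\<dots> \<le> nm (P x - Q x) + real n * nm (P x - Q x)"
    by (intro add_mono funpow_nm_le P order_trans[OF Q(2) Suc])
  finally show ?case by (simp add: distrib_right)
qed simp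

end

locale linear_operator = chilbert sm ip
  for sm :: "complex \<Rightarrow> 'a::ab_group_add \<Rightarrow> 'a" and ip :: "'a \<Rightarrow> 'a \<Rightarrow> complex" +
  fixes D :: "'a set" and G :: "'a \<Rightarrow> 'a"
  assumes lin: "lin_on sm sm D G"
begin

abbreviation rs :: "real \<Rightarrow> 'a \<Rightarrow> 'a" where "rs h \<equiv> sm (complex_of_real h)"

lemma D_zero: "0 \<in> D"
  and D_add: "x \<in> D \<Longrightarrow> y \<in> D \<Longrightarrow> x + y \<in> D"
  and D_scale: "x \<in> D \<Longrightarrow> sm c x \<in> D"
  and G_add: "x \<in> D \<Longrightarrow> y \<in> D \<Longrightarrow> G (x + y) = G x + G y"
  and G_scale: "x \<in> D \<Longrightarrow> G (sm c x) = sm c (G x)"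
  using lin unfolding lin_on_def subspace_on_def by blast+

lemma G_zero: "G 0 = 0"
  using G_scale[OF D_zero, of 0] by simp

lemma D_minus: "x \<in> D \<Longrightarrow> - x \<in> D"
  using D_scale[of x "-1"] by simp

lemma G_minus: "x \<in> D \<Longrightarrow> G (- x) = - G x"
  using G_scale[of x "-1"] by simp

lemma D_diff: "x \<in> D \<Longrightarrow> y \<in> D \<Longrightarrow> x - y \<in> D"
  using D_add[of x "- y"] D_minus by simp

lemma G_diff: "x \<in> D \<Longrightarrow> y \<in> D \<Longrightarrow> G (x - y) = G x - G y"
  using G_add[of x "- y"] D_minus G_minus by simp

end

locale maccretive = linear_operator sm ip D G
  for sm :: "complex \<Rightarrow> 'a::ab_group_add \<Rightarrow> 'a" and ip :: "'a \<Rightarrow> 'a \<Rightarrow> complex"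
    and D :: "'a set" and G :: "'a \<Rightarrow> 'a" +
  assumes dense: "dense_in ip D"
    and accretive: "x \<in> D \<Longrightarrow> Re (ip x (G x)) \<ge> 0"
    and range: "h > 0 \<Longrightarrow> \<exists>x\<in>D. x + sm (complex_of_real h) (G x) = y"
begin

text \<open>Pairing \<open>x + rs h (G x)\<close> with \<open>x\<close> and cancelling one factor
  \<open>nm x\<close>. The margin \<delta> is kept because it becomes the decay rate of the
  semigroup.\<close>

lemma accretive_lower_bound:
  assumes "\<And>x. x \<in> D \<Longrightarrow> Re (ip x (G x)) \<ge> \<delta> * (nm x)\<^sup>2" "x \<in> D" "h \<ge> 0"
  shows "(1 + h * \<delta>) * nm x \<le> nm (x + rs h (G x))"
proof (cases "nm x = 0")
  case False
  then have p: "nm x > 0" using nm_nonneg[of x] by linarith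
  have "h * (\<delta> * (nm x)\<^sup>2) \<le> h * Re (ip x (G x))"
    using assms by (intro mult_left_mono) auto
  then have "(1 + h * \<delta>) * nm x * nm x \<le> Re (ip x (x + rs h (G x)))"
    by (simp add: ip_add_right ip_scale_right ip_self power2_eq_square algebra_simps)
  also have "\<dots> \<le> nm x * nm (x + rs h (G x))"
    using complex_Re_le_cmod Cauchy_Schwarz order_trans by blast
  finally show ?thesis using p by (simp add: mult.commute mult_left_le_imp_le)
qed simp

lemma nm_le_resolvent_arg: "x \<in> D \<Longrightarrow> h \<ge> 0 \<Longrightarrow> nm x \<le> nm (x + rs h (G x))"
  using accretive_lower_bound[of 0 x h] accretive by simp

text \<open>At h = 0 the defining equation is solvable only for y in D, hence the separate case.\<close>

definition J :: "real \<Rightarrow> 'a \<Rightarrow> 'a" where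
  "J h y = (if h = 0 then y else THE x. x \<in> D \<and> x + rs h (G x) = y)"

lemma J_eq:
  assumes "h \<ge> 0" "x \<in> D"
  shows "J h (x + rs h (G x)) = x"
proof (cases "h = 0")
  case False
  have "x' = x" if "x' \<in> D" "x' + rs h (G x') = x + rs h (G x)" for x'
  proof -
    have "nm (x' - x) \<le> nm ((x' - x) + rs h (G (x' - x)))"
      using assms that by (intro nm_le_resolvent_arg D_diff)
    also have "(x' - x) + rs h (G (x' - x)) = 0"
      using that assms by (simp add: G_diff scale_right_diff_distrib algebra_simps)
    finally show ?thesis using nm_nonneg[of "x' - x"] by simp
  qed
  then show ?thesis unfolding J_def using False assms(2) by (auto intro!: the_equality)
qed (simp add: J_def)

lemma J_D: "h > 0 \<Longrightarrow> J h y \<in> D"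
  and J_inverse: "h > 0 \<Longrightarrow> J h y + rs h (G (J h y)) = y"
proof -
  assume h: "h > 0"
  obtain x where x: "x \<in> D" "x + rs h (G x) = y" using range[OF h] by blast
  then have "J h y = x" using J_eq[of h x] h by simp
  with x show "J h y \<in> D" "J h y + rs h (G (J h y)) = y" by auto
qed

lemma J_D': "h \<ge> 0 \<Longrightarrow> y \<in> D \<Longrightarrow> J h y \<in> D"
  using J_D[of h y] by (cases "h = 0") (auto simp: J_def)

lemma J_inverse': "h \<ge> 0 \<Longrightarrow> y \<in> D \<Longrightarrow> J h y + rs h (G (J h y)) = y"
  using J_inverse[of h y] by (cases "h = 0") (auto simp: J_def)

lemma J_bound:
  assumes "\<And>x. x \<in> D \<Longrightarrow> Re (ip x (G x)) \<ge> \<delta> * (nm x)\<^sup>2" "h \<ge> 0" "\<delta> \<ge> 0"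
  shows "nm (J h y) \<le> nm y / (1 + h * \<delta>)"
proof (cases "h = 0")
  case False
  with assms(2) have h: "h > 0" by simp
  have "(1 + h * \<delta>) * nm (J h y) \<le> nm y"
    using accretive_lower_bound[OF assms(1) J_D[OF h, of y] assms(2)] J_inverse[OF h, of y] by simp
  moreover have "1 + h * \<delta> > 0" using assms by (simp add: add_pos_nonneg)
  ultimately show ?thesis by (simp add: field_simps)
qed (simp add: J_def)

lemma J_nm_le: "h \<ge> 0 \<Longrightarrow> nm (J h y) \<le> nm y"
  using J_bound[of 0 h y] accretive by simp

lemma J_add:
  assumes "h \<ge> 0" shows "J h (x + y) = J h x + J h y"
proof (cases "h = 0")
  case False
  with assms have h: "h > 0" by simp
  have "(J h x + J h y) + rs h (G (J h x + J h y)) = (J h x + rs h (G (J h x))) + (J h y + rs h (G (J h y)))"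
    by (simp add: G_add J_D[OF h] scale_right_distrib algebra_simps)
  also have "\<dots> = x + y" by (simp only: J_inverse[OF h])
  finally show ?thesis using J_eq[OF assms D_add[OF J_D[OF h, of x] J_D[OF h, of y]]] by simp
qed (simp add: J_def)

lemma J_scale:
  assumes "h \<ge> 0" shows "J h (sm c x) = sm c (J h x)"
proof (cases "h = 0")
  case False
  with assms have h: "h > 0" by simp
  have "sm c (J h x) + rs h (G (sm c (J h x))) = sm c (J h x + rs h (G (J h x)))"
    by (simp add: G_scale J_D[OF h] scale_right_distrib mult.commute)
  also have "\<dots> = sm c x" by (simp only: J_inverse[OF h])
  finally show ?thesis using J_eq[OF assms D_scale[OF J_D[OF h, of x], of c]] by simp
qed (simp add: J_def)

lemma J_diff: "h \<ge> 0 \<Longrightarrow> J h (x - y) = J h x - J h y"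
  using J_add[of h x "sm (-1) y"] J_scale[of h "-1" y] by simp

text \<open>For x in \<open>D\<close> the vector G (J h x) = (x - J h x) / h is again in
  \<open>D\<close>. Hence G may be applied to the resolvent equation, which shows that G (J h x)
  solves it with right-hand side G x.\<close>

lemma J_G:
  assumes "h \<ge> 0" "x \<in> D" shows "G (J h x) = J h (G x)"
proof (cases "h = 0")
  case False
  with assms have h: "h > 0" by simp
  define u where "u = J h x"
  have u: "u \<in> D" "u + rs h (G u) = x" using J_D[OF h] J_inverse[OF h] by (auto simp: u_def)
  have "rs h (G u) = x - u" using u(2) by (simp add: algebra_simps)
  then have "rs (1 / h) (x - u) = G u" using h by (metis scale_scale scale_one False
    nonzero_divide_eq_eq of_real_1 of_real_mult)
  then have Gu: "G u \<in> D" using D_scale[OF D_diff[OF assms(2) u(1)]] by metis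
  have "G x = G u + rs h (G (G u))"
    using u Gu by (metis G_add G_scale D_scale)
  then show ?thesis using J_eq[OF assms(1) Gu] by (simp add: u_def)
qed (simp add: J_def)

text \<open>\<open>J h\<close> preserves \<open>D\<close> and commutes with G there, so it maps the
  equation solved by \<open>J k x\<close> to the one solved by \<open>J k (J h x)\<close>.\<close>

lemma J_commute:
  assumes "h \<ge> 0" "k \<ge> 0" shows "J h (J k x) = J k (J h x)"
proof (cases "k = 0")
  case False
  with assms have k: "k > 0" by simp
  define u where "u = J k x"
  have u: "u \<in> D" "u + rs k (G u) = x" using J_D[OF k] J_inverse[OF k] by (auto simp: u_def)
  have "J h x = J h u + rs k (G (J h u))"
    using u by (metis J_add J_scale J_G assms(1))
  then show ?thesis using J_eq[OF assms(2) J_D'[OF assms(1) u(1)]] by (simp add: u_def)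
qed (simp add: J_def)

text \<open>The second-order consistency of the resolvents with a semigroup: from
  (1 + sG)(1 + tG) - (1 + (s + t)G) = st GG.\<close>

lemma J_plus:
  assumes "s \<ge> 0" "t \<ge> 0" "x \<in> D" "G x \<in> D"
  shows "nm (J (s + t) x - J s (J t x)) \<le> s * t * nm (G (G x))"
proof -
  define p where "p = J s (J t x)"
  have v: "J t x \<in> D" "G (J t x) \<in> D" using assms by (auto simp: J_D' J_G)
  have p: "p \<in> D" "G p \<in> D" "G (G p) = J s (J t (G (G x)))"
    using assms v by (auto simp: p_def J_D' J_G)
  have e: "p + rs s (G p) = J t x" unfolding p_def using v assms by (intro J_inverse')
  have "x = J t x + rs t (G (J t x))" using assms by (simp add: J_inverse')
  also have "\<dots> = (p + rs s (G p)) + rs t (G p + rs s (G (G p)))"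
    unfolding e[symmetric] using p by (simp add: G_add G_scale D_scale)
  also have "\<dots> = (p + rs (s + t) (G p)) + rs (s * t) (G (G p))"
    by (simp add: scale_right_distrib scale_left_distrib mult.commute algebra_simps)
  finally have x: "x = (p + rs (s + t) (G p)) + rs (s * t) (G (G p))" .
  have st: "s + t \<ge> 0" using assms by simp
  have "J (s + t) x = J (s + t) (p + rs (s + t) (G p)) + rs (s * t) (J (s + t) (G (G p)))"
    by (subst x) (simp only: J_add[OF st] J_scale[OF st])
  then have "J (s + t) x = p + rs (s * t) (J (s + t) (G (G p)))"
    by (simp only: J_eq[OF st p(1)])
  then have "nm (J (s + t) x - p) = s * t * nm (J (s + t) (G (G p)))"
    using assms by (simp add: nm_scale_real del: of_real_mult)
  also have "\<dots> \<le> s * t * nm (G (G x))"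
    using assms unfolding p(3)
    by (intro mult_left_mono order_trans[OF J_nm_le] J_nm_le) auto
  finally show ?thesis by (simp add: p_def)
qed

lemma J_minus_id:
  assumes "h \<ge> 0" "x \<in> D" shows "nm (J h x - x) \<le> h * nm (G x)"
proof -
  have "J h x - x = - rs h (J h (G x))"
    using J_inverse'[OF assms] J_G[OF assms] by (simp add: algebra_simps)
  then have "nm (J h x - x) = h * nm (J h (G x))" using assms by (simp add: nm_scale_real)
  then show ?thesis using assms J_nm_le by (simp add: mult_left_mono)
qed

lemma J_taylor:
  assumes "h \<ge> 0" "x \<in> D" "G x \<in> D"
  shows "nm (J h x - x + rs h (G x)) \<le> h\<^sup>2 * nm (G (G x))"
proof -
  have "J h x - x = - rs h (J h (G x))"
    using J_inverse'[OF assms(1,2)] J_G[OF assms(1,2)] by (simp add: algebra_simps)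
  then have "J h x - x + rs h (G x) = - rs h (J h (G x) - G x)"
    by (simp add: scale_right_diff_distrib)
  then have "nm (J h x - x + rs h (G x)) = h * nm (J h (G x) - G x)"
    using assms by (simp add: nm_scale_real)
  also have "\<dots> \<le> h * (h * nm (G (G x)))"
    using assms by (intro mult_left_mono J_minus_id)
  finally show ?thesis by (simp add: power2_eq_square mult_ac)
qed

text \<open>The domain of the square of G is a core: \<open>J h\<close> smooths x into it, commutes
  with G, and tends strongly to the identity as h tends to 0.\<close>

lemma dense_graph_D2:
  assumes "x \<in> D" "e > 0"
  obtains u where "u \<in> D" "G u \<in> D" "nm (x - u) < e" "nm (G x - G u) < e"
proof -
  \<comment> \<open>\<open>G x\<close> need not lie in \<open>D\<close>, so the rate of
    \<open>J_minus_id\<close> is used at a nearby \<open>w\<close> instead.\<close>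
  obtain w where w: "w \<in> D" "nm (G x - w) < e / 3"
    using dense assms unfolding dense_in_def by (meson divide_pos_pos zero_less_numeral)
  define N where "N = nm (G x) + nm (G w) + 1"
  have n: "N > 0" "nm (G x) \<le> N" "nm (G w) \<le> N"
    using nm_nonneg[of "G x"] nm_nonneg[of "G w"] unfolding N_def by linarith+
  \<comment> \<open>Chosen so that both \<open>h * nm (G x)\<close> and \<open>h * nm (G w)\<close>
    are at most e / 3; the summand 1 in \<open>N\<close> rules out division by zero.\<close>
  define h where "h = e / (3 * N)"
  have h: "h > 0" using assms n by (simp add: h_def)
  have *: "h * N = e / 3"
    using n by (simp add: h_def)
  have hb: "h * nm (G x) \<le> e / 3" "h * nm (G w) \<le> e / 3"
    using mult_left_mono[OF n(2), of h] mult_left_mono[OF n(3), of h] * h by auto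
  define u where "u = J h x"
  have u: "u \<in> D" "rs h (G u) = x - u"
    using J_D[OF h] J_inverse[OF h, of x] by (auto simp: u_def algebra_simps)
  have "rs (1 / h) (x - u) = G u" using h u(2) by (metis scale_scale scale_one
    nonzero_divide_eq_eq of_real_1 of_real_mult less_irrefl)
  then have Gu: "G u \<in> D" using D_scale[OF D_diff[OF assms(1) u(1)]] by metis
  have 1: "nm (x - u) < e"
    using J_minus_id[of h x] assms h hb by (simp add: u_def nm_minus_commute[of x])
  have "G u = J h (G x)" using J_G assms h by (simp add: u_def)
  then have "nm (G x - G u) \<le> nm (G x - w) + nm (w - J h (G x))"
    using nm_triangle_sub[of "G x" "G u" w] by simp
  also have "\<dots> \<le> nm (G x - w) + (nm (w - J h w) + nm (J h w - J h (G x)))"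
    using nm_triangle_sub by simp
  also have "nm (J h w - J h (G x)) \<le> nm (w - G x)"
    using J_nm_le[of h "w - G x"] J_diff h by simp
  also have "nm (w - J h w) \<le> e / 3"
    using J_minus_id[of h w] w h hb by (simp add: nm_minus_commute[of w])
  also have "nm (w - G x) < e / 3" using w by (simp add: nm_minus_commute)
  finally have "nm (G x - G u) < e" using w by simp
  then show ?thesis using that u Gu 1 by blast
qed

lemma dense_D2:
  assumes "e > 0"
  obtains u where "u \<in> D" "G u \<in> D" "nm (y - u) < e"
proof -
  obtain x where x: "x \<in> D" "nm (y - x) < e / 2"
    using dense assms unfolding dense_in_def by (meson half_gt_zero)
  obtain u where u: "u \<in> D" "G u \<in> D" "nm (x - u) < e / 2"
    using dense_graph_D2[OF x(1), of "e / 2"] assms by auto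
  have "nm (y - u) < e" using nm_triangle_sub[of y u x] x u by simp
  then show ?thesis using that u by blast
qed

end

section \<open>The semigroup as a dyadic exponential formula\<close>

context maccretive begin

definition F :: "nat \<Rightarrow> real \<Rightarrow> 'a \<Rightarrow> 'a" where
  "F n t = J (t / 2 ^ n) ^^ (2 ^ n)"

lemma F_diff: "t \<ge> 0 \<Longrightarrow> F n t (x - y) = F n t x - F n t y"
  unfolding F_def by (intro funpow_diff J_diff) simp

lemma F_nm_le: "t \<ge> 0 \<Longrightarrow> nm (F n t x) \<le> nm x"
  unfolding F_def by (intro funpow_nm_le J_nm_le) simp

lemma F_add:
  assumes "t \<ge> 0" shows "F n t (x + y) = F n t x + F n t y"
proof -
  have "(J (t / 2 ^ n) ^^ k) (x + y) = (J (t / 2 ^ n) ^^ k) x + (J (t / 2 ^ n) ^^ k) y" for k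
    by (induction k) (simp_all add: J_add assms)
  then show ?thesis by (simp add: F_def)
qed

lemma F_scale:
  assumes "t \<ge> 0" shows "F n t (sm c x) = sm c (F n t x)"
proof -
  have "(J (t / 2 ^ n) ^^ k) (sm c x) = sm c ((J (t / 2 ^ n) ^^ k) x)" for k
    by (induction k) (simp_all add: J_scale assms)
  then show ?thesis by (simp add: F_def)
qed

text \<open>A refinement replaces each of the 2^n factors \<open>J h\<close> by two factors
  \<open>J (h / 2)\<close>. The defect of one factor is h^2 / 4, and with h = t / 2^n the total over
  2^n factors is t^2 / (4 * 2^n).\<close>

lemma F_step:
  assumes "t \<ge> 0" "x \<in> D" "G x \<in> D"
  shows "nm (F n t x - F (Suc n) t x) \<le> t\<^sup>2 / (4 * 2 ^ n) * nm (G (G x))"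
proof -
  define h where "h = t / 2 ^ n"
  have h: "h \<ge> 0" using assms by (simp add: h_def)
  define P where "P = J h"
  define Q where "Q x = J (h / 2) (J (h / 2) x)" for x
  have h2: "h / 2 \<ge> 0" using h by simp
  have F1: "F n t = P ^^ (2 ^ n)" by (simp add: F_def P_def h_def)
  have "Q ^^ k = J (h / 2) ^^ (2 * k)" for k
    by (induction k) (simp_all add: Q_def fun_eq_iff)
  then have F2: "F (Suc n) t = Q ^^ (2 ^ n)"
    by (simp add: F_def h_def mult.commute)
  have "nm ((P ^^ (2 ^ n)) x - (Q ^^ (2 ^ n)) x) \<le> real (2 ^ n) * nm (P x - Q x)"
  proof (rule funpow_diff_bound)
    show "P (Q x) = Q (P x)" for x
      by (simp only: P_def Q_def J_commute[OF h h2])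
    show "P (x - y) = P x - P y" "nm (P x) \<le> nm x" for x y
      using h by (auto simp: P_def J_diff J_nm_le)
    show "Q (x - y) = Q x - Q y" for x y
      by (simp only: Q_def J_diff[OF h2])
    show "nm (Q x) \<le> nm x" for x
      unfolding Q_def by (rule order_trans[OF J_nm_le[OF h2] J_nm_le[OF h2]])
  qed
  also have "nm (P x - Q x) \<le> (h / 2) * (h / 2) * nm (G (G x))"
    using J_plus[OF h2 h2 assms(2,3)] by (simp add: P_def Q_def)
  also have "real (2 ^ n) * ((h / 2) * (h / 2) * nm (G (G x))) = t\<^sup>2 / (4 * 2 ^ n) * nm (G (G x))"
    by (simp add: h_def field_simps power2_eq_square)
  finally show ?thesis by (simp add: F1 F2 mult_left_mono)
qed

text \<open>The step errors are summed in telescoping form, from 1 / (4 * 2^j) = (1 / 2^j - 1 /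
  2^(j+1)) / 2.\<close>

lemma F_Cauchy_bound:
  assumes "t \<ge> 0" "x \<in> D" "G x \<in> D"
  shows "nm (F m t x - F (m + k) t x) \<le> t\<^sup>2 / 2 * nm (G (G x)) * (1 / 2 ^ m - 1 / 2 ^ (m + k))"
proof (induction k)
  case (Suc k)
  have "nm (F m t x - F (m + Suc k) t x) \<le>
    nm (F m t x - F (m + k) t x) + nm (F (m + k) t x - F (Suc (m + k)) t x)"
    using nm_triangle_sub by simp
  also have "\<dots> \<le> t\<^sup>2 / 2 * nm (G (G x)) * (1 / 2 ^ m - 1 / 2 ^ (m + k)) + t\<^sup>2 / (4 * 2 ^ (m + k)) * nm (G (G x))"
    by (intro add_mono Suc F_step assms)
  also have "\<dots> = t\<^sup>2 / 2 * nm (G (G x)) * (1 / 2 ^ m - 1 / 2 ^ (m + Suc k))"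
    by (simp add: field_simps)
  finally show ?case .
qed simp

text \<open>The geometric rate is available only on the domain of the square of G. Uniform
  contractivity of \<open>F n t\<close> transfers the Cauchy property to every \<open>y\<close> by
  approximation.\<close>

lemma F_converges:
  assumes t: "t \<ge> 0"
  shows "\<exists>l. tends (\<lambda>n. F n t y) l sequentially"
proof (rule complete)
  fix e :: real assume e: "e > 0"
  obtain x where x: "x \<in> D" "G x \<in> D" "nm (y - x) < e / 12"
    using dense_D2[of "e / 12" y] e by auto
  define K where "K = t\<^sup>2 / 2 * nm (G (G x))"
  have K: "K \<ge> 0" by (simp add: K_def)
  have "(\<lambda>m. K * (1 / 2) ^ m) \<longlonglongrightarrow> K * 0"
    by (intro tendsto_intros LIMSEQ_power_zero) auto
  then have "eventually (\<lambda>m. K * (1 / 2) ^ m < e / 6) sequentially"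
    by (rule order_tendstoD(2)) (simp add: e)
  then obtain N where N: "K * (1 / 2) ^ N < e / 6"
    unfolding eventually_sequentially by blast
  have near: "nm (F N t y - F n t y) < e / 2" if "n \<ge> N" for n
  proof -
    obtain k where k: "n = N + k" using le_Suc_ex[OF \<open>n \<ge> N\<close>] by auto
    have "K * (1 / 2 ^ N - 1 / 2 ^ n) \<le> K * (1 / 2) ^ N"
      using K by (intro mult_left_mono) (auto simp: power_one_over)
    then have 1: "nm (F N t x - F n t x) < e / 6"
      using F_Cauchy_bound[OF t x(1,2), of N k] N unfolding K_def k by linarith
    have 2: "nm (F m t y - F m t x) < e / 12" for m
      using F_nm_le[OF t, of m "y - x"] x(3) by (simp add: F_diff[OF t])
    have "nm (F N t y - F n t y) \<le> nm (F N t y - F N t x) + (nm (F N t x - F n t x) + nm (F n t x - F n t y))"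
      using nm_triangle_sub[of "F N t y" "F n t y" "F N t x"] nm_triangle_sub[of "F N t x" "F n t y" "F n t x"] by simp
    then show ?thesis
      using 1 2[of N] 2[of n] nm_minus_commute[of "F n t x" "F n t y"] e by simp
  qed
  have "nm (F n t y - F m t y) < e" if "n \<ge> N" "m \<ge> N" for m n
    using near[OF that(1)] near[OF that(2)] nm_triangle_sub[of "F n t y" "F m t y" "F N t y"]
      nm_minus_commute[of "F n t y" "F N t y"] by simp
  then show "\<exists>N. \<forall>m\<ge>N. \<forall>n\<ge>N. nm (F m t y - F n t y) < e" by blast
qed

section \<open>The limit semigroup: growth, semigroup law, continuity and generator\<close>

definition T :: "real \<Rightarrow> 'a \<Rightarrow> 'a" where
  "T t y = (SOME l. tends (\<lambda>n. F n t y) l sequentially)"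

lemma F_tends_T: "t \<ge> 0 \<Longrightarrow> tends (\<lambda>n. F n t y) (T t y) sequentially"
  unfolding T_def using F_converges by (rule someI_ex)

lemma T_eqI: "t \<ge> 0 \<Longrightarrow> tends (\<lambda>n. F n t y) l sequentially \<Longrightarrow> T t y = l"
  using tends_unique[OF sequentially_bot F_tends_T] by blast

lemma T_add: "t \<ge> 0 \<Longrightarrow> T t (x + y) = T t x + T t y"
  by (rule T_eqI) (simp_all add: F_add F_tends_T tends_add)

lemma T_scale: "t \<ge> 0 \<Longrightarrow> T t (sm c x) = sm c (T t x)"
  by (rule T_eqI) (simp_all add: F_scale F_tends_T tends_scale)

lemma T_diff: "t \<ge> 0 \<Longrightarrow> T t (x - y) = T t x - T t y"
  by (rule T_eqI) (simp_all add: F_diff F_tends_T tends_diff)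

lemma T_nm_le: "t \<ge> 0 \<Longrightarrow> nm (T t x) \<le> nm x"
  using LIMSEQ_le_const2[OF tends_nm[OF F_tends_T]] F_nm_le by blast

lemma T_zero: "T 0 x = x"
proof (rule T_eqI)
  have "(J 0 ^^ k) x = x" for k by (induction k) (simp_all add: J_def)
  then show "tends (\<lambda>n. F n 0 x) x sequentially" by (simp add: F_def)
qed simp

text \<open>The margin improves the contraction \<open>J h\<close> to the factor 1 / (1 + h *
  \<delta>), and its 2^n-th power at h = t / 2^n is Euler's approximation of the exponential along
  the subsequence 2^n.\<close>

lemma T_nm_le_exp:
  assumes "\<And>x. x \<in> D \<Longrightarrow> Re (ip x (G x)) \<ge> \<delta> * (nm x)\<^sup>2" "\<delta> \<ge> 0" and t: "t \<ge> 0"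
  shows "nm (T t y) \<le> exp (- \<delta> * t) * nm y"
proof -
  have *: "nm ((J h ^^ k) y) \<le> nm y / (1 + h * \<delta>) ^ k" if h: "h \<ge> 0" for h k
  proof (induction k)
    case (Suc k)
    have "nm ((J h ^^ Suc k) y) \<le> nm ((J h ^^ k) y) / (1 + h * \<delta>)"
      using J_bound[OF assms(1) h assms(2)] by simp
    also have "\<dots> \<le> nm y / (1 + h * \<delta>) ^ k / (1 + h * \<delta>)"
      using h assms(2) by (intro divide_right_mono Suc) simp
    finally show ?case by (simp add: mult.commute)
  qed simp
  have bd: "nm (F n t y) \<le> nm y / (1 + t * \<delta> / real (2 ^ n)) ^ (2 ^ n)" for n
    unfolding F_def using *[of "t / 2 ^ n" "2 ^ n"] t by simp
  have "(\<lambda>n. (1 + t * \<delta> / real n) ^ n) \<longlonglongrightarrow> exp (t * \<delta>)"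
    by (rule tendsto_exp_limit_sequentially)
  from LIMSEQ_subseq_LIMSEQ[OF this, of "\<lambda>n. 2 ^ n"]
  have "(\<lambda>n. (1 + t * \<delta> / real (2 ^ n)) ^ (2 ^ n)) \<longlonglongrightarrow> exp (t * \<delta>)"
    by (simp add: strict_mono_def o_def)
  then have "(\<lambda>n. nm y / (1 + t * \<delta> / real (2 ^ n)) ^ (2 ^ n)) \<longlonglongrightarrow> nm y / exp (t * \<delta>)"
    by (intro tendsto_divide tendsto_const) auto
  from LIMSEQ_le[OF tends_nm[OF F_tends_T[OF t]] this] bd
  have "nm (T t y) \<le> nm y / exp (t * \<delta>)" by blast
  then show ?thesis by (simp add: exp_minus field_simps)
qed

lemma T_minus_id:
  assumes t: "t \<ge> 0" and x: "x \<in> D"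
  shows "nm (T t x - x) \<le> t * nm (G x)"
proof -
  have "nm (F n t x - x) \<le> t * nm (G x)" for n
  proof -
    have h: "t / 2 ^ n \<ge> 0" using t by simp
    \<comment> \<open>Telescoping against the identity: 2^n steps, each moving x by at most t / 2^n
      times \<open>nm (G x)\<close>.\<close>
    have "nm ((J (t / 2 ^ n) ^^ (2 ^ n)) x - (id ^^ (2 ^ n)) x) \<le> real (2 ^ n) * nm (J (t / 2 ^ n) x - id x)"
      by (rule funpow_diff_bound) (auto simp: J_diff[OF h] J_nm_le[OF h])
    also have "\<dots> \<le> real (2 ^ n) * (t / 2 ^ n * nm (G x))"
      using J_minus_id[OF h x] by (intro mult_left_mono) auto
    finally show ?thesis by (simp add: F_def)
  qed
  then show ?thesis
    using LIMSEQ_le_const2[OF tends_nm[OF tends_diff[OF F_tends_T[OF t] tends_const]]] by blast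
qed

text \<open>Starting the Cauchy bound at m = 0 compares \<open>T t\<close> with the single resolvent
  \<open>J t\<close>, whose expansion is elementary. The constants 1 and 1/2 add up to 3/2, rounded
  up to 2.\<close>

lemma T_taylor:
  assumes t: "t \<ge> 0" and x: "x \<in> D" "G x \<in> D"
  shows "nm (T t x - x + rs t (G x)) \<le> 2 * t\<^sup>2 * nm (G (G x))"
proof -
  have F0: "F 0 t = J t" by (simp add: F_def)
  have "nm (J t x - F n t x) \<le> t\<^sup>2 / 2 * nm (G (G x))" for n
  proof -
    have "nm (J t x - F n t x) \<le> t\<^sup>2 / 2 * nm (G (G x)) * (1 - 1 / 2 ^ n)"
      using F_Cauchy_bound[OF t x, of 0 n] by (simp add: F0)
    also have "\<dots> \<le> t\<^sup>2 / 2 * nm (G (G x)) * 1"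
      by (intro mult_left_mono) auto
    finally show ?thesis by simp
  qed
  then have 1: "nm (J t x - T t x) \<le> t\<^sup>2 / 2 * nm (G (G x))"
    using LIMSEQ_le_const2[OF tends_nm[OF tends_diff[OF tends_const F_tends_T[OF t]]]] by blast
  have "(J t x - x + rs t (G x)) - (J t x - T t x) = T t x - x + rs t (G x)" by simp
  then have "nm (T t x - x + rs t (G x)) \<le> nm (J t x - x + rs t (G x)) + nm (J t x - T t x)"
    using nm_triangle_minus[of "J t x - x + rs t (G x)" "J t x - T t x"] by (simp only:)
  also have "\<dots> \<le> t\<^sup>2 * nm (G (G x)) + t\<^sup>2 / 2 * nm (G (G x))"
    by (intro add_mono 1 J_taylor t x)
  also have "\<dots> \<le> 2 * t\<^sup>2 * nm (G (G x))"
    by simp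
  finally show ?thesis .
qed

text \<open>At a fixed level \<open>n\<close> the steps s / 2^n and t / 2^n are merged into one. The
  defect is s t / 4^n per factor and s t / 2^n in total, for all real s and t, so no passage through
  dyadic times is needed.\<close>

lemma F_plus:
  assumes s: "s \<ge> 0" and t: "t \<ge> 0" and x: "x \<in> D" "G x \<in> D"
  shows "nm (F n (s + t) x - F n s (F n t x)) \<le> s * t * nm (G (G x)) / 2 ^ n"
proof -
  define N :: nat where "N = 2 ^ n"
  have N: "N > 0" "real N = 2 ^ n" by (auto simp: N_def)
  define P where "P = J ((s + t) / 2 ^ n)"
  define Q where "Q x = J (s / 2 ^ n) (J (t / 2 ^ n) x)" for x
  have h: "s / 2 ^ n \<ge> 0" "t / 2 ^ n \<ge> 0" "(s + t) / 2 ^ n \<ge> 0" using s t by auto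
  \<comment> \<open>Commuting resolvents let the powers of the product split, which turns them into
    \<open>F n s (F n t x)\<close>.\<close>
  have Qk: "(Q ^^ k) y = (J (s / 2 ^ n) ^^ k) ((J (t / 2 ^ n) ^^ k) y)" for k y
  proof (induction k)
    case (Suc k)
    have "J (t / 2 ^ n) ((J (s / 2 ^ n) ^^ k) z) = (J (s / 2 ^ n) ^^ k) (J (t / 2 ^ n) z)" for z
      by (rule funpow_commute[symmetric]) (rule J_commute[OF h(1,2)])
    then have "Q ((Q ^^ k) y) = (J (s / 2 ^ n) ^^ Suc k) ((J (t / 2 ^ n) ^^ Suc k) y)"
      unfolding Suc by (simp add: Q_def)
    then show ?case by simp
  qed simp
  have "nm ((P ^^ N) x - (Q ^^ N) x) \<le> real N * nm (P x - Q x)"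
  proof (rule funpow_diff_bound)
    show "P (Q x) = Q (P x)" for x
      unfolding P_def Q_def by (metis J_commute h)
    show "P (x - y) = P x - P y" "nm (P x) \<le> nm x" for x y
      using h by (auto simp: P_def J_diff J_nm_le)
    show "Q (x - y) = Q x - Q y" for x y
      by (simp only: Q_def J_diff h)
    show "nm (Q x) \<le> nm x" for x
      unfolding Q_def by (rule order_trans[OF J_nm_le[OF h(1)] J_nm_le[OF h(2)]])
  qed
  also have "\<dots> \<le> real N * ((s / 2 ^ n) * (t / 2 ^ n) * nm (G (G x)))"
    using J_plus[OF h(1,2) x] by (intro mult_left_mono) (simp_all add: P_def Q_def add_divide_distrib)
  also have "\<dots> = s * t * nm (G (G x)) / 2 ^ n"
    using N by (simp add: field_simps)
  finally show ?thesis by (simp add: F_def P_def Qk N_def)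
qed

lemma F_F_tends:
  assumes s: "s \<ge> 0" and t: "t \<ge> 0"
  shows "tends (\<lambda>n. F n s (F n t x)) (T s (T t x)) sequentially"
proof (rule tends_bound)
  show "(\<lambda>n. nm (F n t x - T t x) + nm (F n s (T t x) - T s (T t x))) \<longlonglongrightarrow> 0"
    using tendsto_add[OF F_tends_T[OF t, of x, unfolded tends_def] F_tends_T[OF s, of "T t x", unfolded tends_def]] by simp
  have "nm (F n s (F n t x) - T s (T t x)) \<le> nm (F n t x - T t x) + nm (F n s (T t x) - T s (T t x))" for n
  proof -
    have "nm (F n s (F n t x) - F n s (T t x)) \<le> nm (F n t x - T t x)"
      using F_nm_le[OF s, of n "F n t x - T t x"] by (simp add: F_diff[OF s])
    then show ?thesis
      using nm_triangle_sub[of "F n s (F n t x)" "T s (T t x)" "F n s (T t x)"] by simp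
  qed
  then show "eventually (\<lambda>n. nm (F n s (F n t x) - T s (T t x))
    \<le> nm (F n t x - T t x) + nm (F n s (T t x) - T s (T t x))) sequentially" by simp
qed

lemma T_plus_D2:
  assumes s: "s \<ge> 0" and t: "t \<ge> 0" and x: "x \<in> D" "G x \<in> D"
  shows "T (s + t) x = T s (T t x)"
proof -
  have st: "s + t \<ge> 0" using s t by simp
  have "(\<lambda>n. s * t * nm (G (G x)) * (1 / 2) ^ n) \<longlonglongrightarrow> s * t * nm (G (G x)) * 0"
    by (intro tendsto_intros LIMSEQ_power_zero) auto
  then have lim: "(\<lambda>n. s * t * nm (G (G x)) / 2 ^ n) \<longlonglongrightarrow> 0"
    by (simp add: power_one_over)
  have "tends (\<lambda>n. F n (s + t) x - F n s (F n t x)) 0 sequentially"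
    using F_plus[OF s t x] by (intro tends_bound[OF lim]) simp
  moreover have "tends (\<lambda>n. F n (s + t) x - F n s (F n t x)) (T (s + t) x - T s (T t x)) sequentially"
    by (intro tends_diff F_tends_T F_F_tends s t st)
  ultimately have "T (s + t) x - T s (T t x) = 0"
    using tends_unique[OF sequentially_bot] by blast
  then show ?thesis by simp
qed

lemma T_plus:
  assumes s: "s \<ge> 0" and t: "t \<ge> 0"
  shows "T (s + t) y = T s (T t y)"
proof (rule ccontr)
  assume "T (s + t) y \<noteq> T s (T t y)"
  then have "nm (T (s + t) y - T s (T t y)) \<noteq> 0" by simp
  then have e: "nm (T (s + t) y - T s (T t y)) / 2 > 0" (is "?e > 0")
    using nm_nonneg[of "T (s + t) y - T s (T t y)"] by linarith
  obtain x where x: "x \<in> D" "G x \<in> D" "nm (y - x) < ?e" using dense_D2[OF e] by blast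
  \<comment> \<open>The semigroup law holds at \<open>x\<close>, so its contribution cancels and
    only the approximation error y - x is left, at most twice its norm.\<close>
  have "T (s + t) y - T s (T t y) = T (s + t) (y - x) - T s (T t (y - x))"
    using s t T_plus_D2[OF s t x(1,2)] by (simp add: T_diff)
  then have "nm (T (s + t) y - T s (T t y)) \<le> nm (T (s + t) (y - x)) + nm (T s (T t (y - x)))"
    using nm_triangle_minus by simp
  also have "\<dots> \<le> nm (y - x) + nm (y - x)"
    using s t by (intro add_mono T_nm_le order_trans[OF T_nm_le[OF s] T_nm_le[OF t]]) simp
  finally show False using x(3) by simp
qed

lemma T_tends_id:
  assumes "e > 0"
  shows "\<exists>d>0. \<forall>t. 0 \<le> t \<and> t < d \<longrightarrow> nm (T t y - y) < e"
proof -
  obtain x where x: "x \<in> D" "nm (y - x) < e / 3"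
    using dense assms unfolding dense_in_def by (meson divide_pos_pos zero_less_numeral)
  define d where "d = e / (3 * (nm (G x) + 1))"
  have n: "nm (G x) + 1 > 0" using nm_nonneg[of "G x"] by linarith
  have d: "d > 0" using assms n by (simp add: d_def)
  have "nm (T t y - y) < e" if t: "0 \<le> t" "t < d" for t
  proof -
    have "t * nm (G x) \<le> d * (nm (G x) + 1)" using t by (intro mult_mono) auto
    also have "\<dots> = e / 3" using n unfolding d_def by (simp add: divide_simps)
    finally have 1: "nm (T t x - x) \<le> e / 3" using T_minus_id[OF t(1) x(1)] by linarith
    have eq: "T t y - y = (T t (y - x) + (T t x - x)) - (y - x)" using t by (simp add: T_diff)
    have "nm (T t y - y) \<le> nm (T t (y - x)) + nm (T t x - x) + nm (y - x)"
      unfolding eq using nm_triangle_minus[of "T t (y - x) + (T t x - x)" "y - x"]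
        nm_triangle[of "T t (y - x)" "T t x - x"] by linarith
    then show ?thesis using 1 x(2) T_nm_le[OF t(1), of "y - x"] by linarith
  qed
  then show ?thesis using d by blast
qed

lemma T_continuous:
  assumes t0: "t0 \<ge> 0"
  shows "tends (\<lambda>t. T t y) (T t0 y) (at t0 within {0..})"
  unfolding tends_def
proof (rule tendstoI)
  fix e :: real assume "e > 0"
  then obtain d where d: "d > 0" "\<And>t. 0 \<le> t \<Longrightarrow> t < d \<Longrightarrow> nm (T t y - y) < e"
    using T_tends_id by blast
  \<comment> \<open>The estimate is uniform in \<open>r\<close>: taking r = t0 gives continuity from
    the right, taking r = t continuity from the left.\<close>
  have *: "nm (T (r + u) y - T r y) < e" if "r \<ge> 0" "u \<ge> 0" "u < d" for r u
  proof -
    have "T (r + u) y - T r y = T r (T u y - y)" using that by (simp add: T_plus T_diff)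
    then show ?thesis using T_nm_le[OF that(1), of "T u y - y"] d(2)[OF that(2,3)] by simp
  qed
  have "nm (T t y - T t0 y) < e" if "t \<ge> 0" "dist t t0 < d" for t
  proof (cases "t0 \<le> t")
    case True
    then show ?thesis using *[OF t0, of "t - t0"] that by (simp add: dist_real_def)
  next
    case False
    then have "nm (T t0 y - T t y) < e"
      using *[OF that(1), of "t0 - t"] that by (simp add: dist_real_def)
    then show ?thesis by (simp only: nm_minus_commute)
  qed
  then have "\<forall>t\<in>{0..}. t \<noteq> t0 \<and> dist t t0 < d \<longrightarrow> dist (nm (T t y - T t0 y)) 0 < e"
    by simp
  then show "eventually (\<lambda>t. dist (nm (T t y - T t0 y)) 0 < e) (at t0 within {0..})"
    unfolding eventually_at using d(1) by blast
qed

text \<open>The Taylor estimate requires G x in \<open>D\<close>, so x is replaced by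
  \<open>u\<close> close to it in the graph norm. By \<open>T_minus_id\<close> the replacement costs
  at most h times \<open>nm (G x - G u)\<close> in each of two terms, which remains small after
  division by h.\<close>

lemma T_derivative:
  assumes x: "x \<in> D"
  shows "tends (\<lambda>h. rs (1 / h) (T h x - x)) (- G x) (at_right 0)"
  unfolding tends_def
proof (rule tendstoI)
  fix e :: real assume e: "e > 0"
  then obtain u where u: "u \<in> D" "G u \<in> D" "nm (G x - G u) < e / 4"
    using dense_graph_D2[OF x, of "e / 4"] by auto
  define K where "K = 2 * nm (G (G u)) + 1"
  have K: "K > 0" "2 * nm (G (G u)) \<le> K" using nm_nonneg[of "G (G u)"] unfolding K_def by linarith+
  define d where "d = e / (4 * K)"
  have d: "d > 0" "d * K = e / 4" using e K by (auto simp: d_def)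
  have "nm (rs (1 / h) (T h x - x) - - G x) < e" if h: "0 < h" "h < d" for h
  proof -
    have eq: "T h x - x + rs h (G x) = (T h (x - u) - (x - u)) + (T h u - u + rs h (G u)) + rs h (G x - G u)"
      using h by (simp add: T_diff scale_right_diff_distrib)
    have "nm (T h x - x + rs h (G x)) \<le>
      nm (T h (x - u) - (x - u)) + nm (T h u - u + rs h (G u)) + nm (rs h (G x - G u))"
      unfolding eq using nm_triangle[of "(T h (x - u) - (x - u)) + (T h u - u + rs h (G u))" "rs h (G x - G u)"]
        nm_triangle[of "T h (x - u) - (x - u)" "T h u - u + rs h (G u)"] by linarith
    also have "\<dots> \<le> h * nm (G x - G u) + 2 * h\<^sup>2 * nm (G (G u)) + h * nm (G x - G u)"
      using T_minus_id[of h "x - u"] T_taylor[of h u] h x u by (simp add: D_diff G_diff nm_scale_real)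
    also have "\<dots> = h * (2 * nm (G x - G u) + h * (2 * nm (G (G u))))"
      by (simp add: algebra_simps power2_eq_square)
    also have "\<dots> < h * e"
    proof -
      have "h * (2 * nm (G (G u))) \<le> d * K" using h K by (intro mult_mono) auto
      then have "2 * nm (G x - G u) + h * (2 * nm (G (G u))) < e" using u(3) d(2) e by linarith
      then show ?thesis using h by simp
    qed
    finally have "nm (T h x - x + rs h (G x)) < h * e" .
    moreover have "rs (1 / h) (T h x - x) - - G x = rs (1 / h) (T h x - x + rs h (G x))"
      using h by (simp add: scale_right_distrib)
    then have "nm (rs (1 / h) (T h x - x) - - G x) = nm (T h x - x + rs h (G x)) / h"
      using h by (simp only: nm_scale_real) simp
    ultimately show ?thesis using h by (metis mult.commute pos_divide_less_eq)
  qed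
  then have "\<forall>h>0. h < d \<longrightarrow> dist (nm (rs (1 / h) (T h x - x) - - G x)) 0 < e"
    by (simp only: dist_0_norm real_norm_def abs_of_nonneg nm_nonneg dist_commute) blast
  then show "eventually (\<lambda>h. dist (nm (rs (1 / h) (T h x - x) - - G x)) 0 < e) (at_right 0)"
    unfolding eventually_at_right_field using d(1) by blast
qed

text \<open>By accretivity the generator of T has no proper extension: solving u + G u = y - z with u in D,
  the difference quotients of T at w = y - u converge to w itself, so contractivity forces w = 0.\<close>

lemma T_derivative_domain:
  assumes z: "tends (\<lambda>h. rs (1 / h) (T h y - y)) z (at_right 0)"
  shows "y \<in> D"
proof -
  obtain u where u: "u \<in> D" "u + rs 1 (G u) = y - z" using range[of 1] by force
  define w where "w = y - u"
  have "tends (\<lambda>h. rs (1 / h) (T h y - y) - rs (1 / h) (T h u - u)) (z - - G u) (at_right 0)"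
    by (intro tends_diff z T_derivative u)
  moreover have "z - - G u = w" using u(2) by (simp add: w_def algebra_simps)
  moreover have "eventually (\<lambda>h. rs (1 / h) (T h y - y) - rs (1 / h) (T h u - u) = rs (1 / h) (T h w - w)) (at_right 0)"
    using eventually_at_right_less[of "0::real"]
    by eventually_elim (simp add: w_def T_diff scale_right_diff_distrib)
  ultimately have "tends (\<lambda>h. rs (1 / h) (T h w - w)) w (at_right 0)"
    unfolding tends_def by (auto elim!: Lim_transform_eventually elim: eventually_mono)
  from tendsto_Re[OF tends_ip_right[OF this]]
  have lim: "((\<lambda>h. Re (ip w (rs (1 / h) (T h w - w)))) \<longlongrightarrow> Re (ip w w)) (at_right 0)" .
  have "Re (ip w w) \<le> 0"
  proof (rule tendsto_upperbound[OF lim])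
    have "Re (ip w (rs (1 / h) (T h w - w))) \<le> 0" if "h > 0" for h
    proof -
      have "Re (ip w (T h w)) \<le> nm w * nm (T h w)"
        using complex_Re_le_cmod Cauchy_Schwarz order_trans by blast
      also have "\<dots> \<le> nm w * nm w" using that by (intro mult_left_mono T_nm_le) auto
      finally have "Re (ip w (T h w - w)) \<le> 0"
        by (simp add: ip_diff_right nm_square[symmetric] power2_eq_square)
      then show ?thesis using that by (simp add: ip_scale_right divide_nonpos_pos)
    qed
    then show "eventually (\<lambda>h. Re (ip w (rs (1 / h) (T h w - w))) \<le> 0) (at_right 0)"
      using eventually_at_right_less[of "0::real"] by (auto elim: eventually_mono)
  qed simp
  then have "(nm w)\<^sup>2 \<le> 0" by (simp only: nm_square)
  then have "w = 0" by simp
  then show ?thesis using u(1) by (simp add: w_def)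
qed

end

section \<open>Quasi-accretive operators\<close>

text \<open>Surjectivity is demanded only beyond a threshold \<open>L\<close>, which is what a
  perturbation argument delivers; \<open>shift_surj\<close> extends it to a half plane determined by
  the lower bound alone.\<close>

locale quasi_maccretive = linear_operator sm ip D G
  for sm :: "complex \<Rightarrow> 'a::ab_group_add \<Rightarrow> 'a" and ip :: "'a \<Rightarrow> 'a \<Rightarrow> complex"
    and D :: "'a set" and G :: "'a \<Rightarrow> 'a" +
  fixes \<mu> L :: real
  assumes dense: "dense_in ip D"
    and quasi_accretive: "x \<in> D \<Longrightarrow> Re (ip x (G x)) \<ge> - \<mu> * (nm x)\<^sup>2"
    and range_large: "r > L \<Longrightarrow> \<exists>x\<in>D. sm (complex_of_real r) x + G x = y"
begin

text \<open>The constant \<nu> is any valid lower bound and not tied to \<mu>, so that the resolvent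
  estimate can be read off for every admissible constant.\<close>

lemma shift_lower_bound:
  assumes "\<And>x. x \<in> D \<Longrightarrow> Re (ip x (G x)) \<ge> - \<nu> * (nm x)\<^sup>2" "x \<in> D"
  shows "(Re w - \<nu>) * nm x \<le> nm (sm w x + G x)"
proof (cases "nm x = 0")
  case False
  then have p: "nm x > 0" using nm_nonneg[of x] by linarith
  have "Re (w * ip x x) = Re w * (nm x)\<^sup>2" unfolding ip_self by simp
  then have "(Re w - \<nu>) * nm x * nm x \<le> Re (ip x (sm w x + G x))"
    using assms(1)[OF assms(2)]
    by (simp add: ip_add_right ip_scale_right power2_eq_square left_diff_distrib)
  also have "\<dots> \<le> nm x * nm (sm w x + G x)"
    using complex_Re_le_cmod Cauchy_Schwarz order_trans by blast
  finally show ?thesis using p by (simp add: mult.commute mult_left_le_imp_le)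
qed simp

text \<open>For large real R the disc around R with radius R - \<mu> contains w, so a single Neumann step
  leads from R to w.\<close>

lemma shift_surj:
  assumes low: "\<And>x. x \<in> D \<Longrightarrow> Re (ip x (G x)) \<ge> - \<nu> * (nm x)\<^sup>2" and w: "Re w > \<nu>"
  shows "\<exists>x\<in>D. sm w x + G x = y"
proof -
  \<comment> \<open>Squaring |w - R| < R - \<nu> cancels R^2, and what remains is linear in R: it
    says exactly R > c.\<close>
  define c where "c = ((cmod w)\<^sup>2 - \<nu>\<^sup>2) / (2 * (Re w - \<nu>))"
  define R where "R = max L (max \<nu> c) + 1"
  have R: "R > L" "R > \<nu>" "R > c" by (auto simp: R_def)
  define k where "k = R - \<nu>"
  have k: "k > 0" using R by (simp add: k_def)
  have "(cmod w)\<^sup>2 - \<nu>\<^sup>2 < R * (2 * (Re w - \<nu>))"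
    using R(3) w by (simp add: c_def pos_divide_less_eq)
  moreover have "(cmod w)\<^sup>2 = (Re w)\<^sup>2 + (Im w)\<^sup>2" by (rule cmod_power2)
  moreover have "(cmod (w - of_real R))\<^sup>2 = (Re w - R)\<^sup>2 + (Im w)\<^sup>2" by (simp add: cmod_power2)
  ultimately have "(cmod (w - of_real R))\<^sup>2 < k\<^sup>2"
    unfolding k_def by (simp add: power2_eq_square algebra_simps)
  then have ck: "cmod (w - of_real R) < k" using k by (simp add: power2_less_imp_less)
  have bd: "k * nm x \<le> nm (rs R x + G x)" if "x \<in> D" for x
    using shift_lower_bound[OF low that, of "of_real R"] by (simp add: k_def)
  have "\<exists>x\<in>D. (rs R x + G x) + sm (w - of_real R) x = y"
  proof (rule relatively_bounded_perturbation_surj)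
    show "\<exists>x\<in>D. rs R x + G x = y" for y by (rule range_large[OF R(1)])
    show "nm (sm (w - of_real R) x) \<le> cmod (w - of_real R) / k * nm (rs R x + G x)" if "x \<in> D" for x
      using mult_left_mono[OF bd[OF that], of "cmod (w - of_real R)"] k
      by (simp only: nm_scale) (simp add: pos_le_divide_eq mult_ac)
    show "0 \<le> cmod (w - of_real R) / k" "cmod (w - of_real R) / k < 1"
      using ck k by auto
  qed (simp_all add: D_diff G_diff scale_right_diff_distrib)
  then show ?thesis by (simp add: scale_left_diff_distrib algebra_simps)
qed

lemma maccretive_shift: "maccretive sm ip D (\<lambda>x. G x + rs \<mu> x)"
proof
  show "lin_on sm sm D (\<lambda>x. G x + rs \<mu> x)"
    using lin by (auto simp: lin_on_def scale_right_distrib mult.commute algebra_simps)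
  show "dense_in ip D" by (rule dense)
  show "Re (ip x (G x + rs \<mu> x)) \<ge> 0" if "x \<in> D" for x
    using quasi_accretive[OF that] by (simp add: ip_add_right ip_scale_right nm_square)
  show "\<exists>x\<in>D. x + rs h (G x + rs \<mu> x) = y" if h: "h > 0" for h y
  proof -
    \<comment> \<open>Dividing by h turns 1 + h (G + \<mu>) into (1 / h + \<mu>) + G, a shift whose
      real part exceeds \<mu>.\<close>
    obtain x where x: "x \<in> D" "sm (of_real (1 / h + \<mu>)) x + G x = rs (1 / h) y"
      using shift_surj[OF quasi_accretive, of "of_real (1 / h + \<mu>)" "rs (1 / h) y"] h by auto
    have "rs h (rs (1 / h + \<mu>) x + G x) = rs h (rs (1 / h) y)" using x(2) by simp
    then have "x + rs h (G x + rs \<mu> x) = y"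
      using h by (simp add: scale_right_distrib scale_left_distrib distrib_left algebra_simps)
    then show ?thesis using x(1) by blast
  qed
qed

text \<open>The product rule at time 0. With m = \<mu> it passes from the contraction semigroup to
  \<open>semi\<close>, with m = -\<mu> back again.\<close>

lemma tends_rescaled_quotient:
  assumes "tends (\<lambda>h. rs (1 / h) (f h - y)) z (at_right 0)"
  shows "tends (\<lambda>h. rs (1 / h) (rs (exp (m * h)) (f h) - y)) (z + rs m y) (at_right 0)"
proof -
  have "((\<lambda>h. exp (m * h)) has_real_derivative m) (at 0)"
    by (auto intro!: derivative_eq_intros)
  then have "((\<lambda>h. (exp (m * h) - 1) / h) \<longlongrightarrow> m) (at_right 0)"
    unfolding has_field_derivative_iff by (auto intro: filterlim_mono simp: at_within_def intro!: inf_mono elim: tendsto_mono[rotated])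
  then have 1: "((\<lambda>h. complex_of_real ((exp (m * h) - 1) / h)) \<longlongrightarrow> of_real m) (at_right 0)"
    by (rule tendsto_of_real)
  have "((\<lambda>h. exp (m * h)) \<longlongrightarrow> exp (m * 0)) (at_right (0::real))"
    by (intro tendsto_intros)
  then have 2: "((\<lambda>h. complex_of_real (exp (m * h))) \<longlongrightarrow> 1) (at_right 0)"
    using tendsto_of_real by fastforce
  have eq: "rs (1 / h) (rs (exp (m * h)) (f h) - y)
      = rs (exp (m * h)) (rs (1 / h) (f h - y)) + rs ((exp (m * h) - 1) / h) y" for h
  proof -
    have "rs ((exp (m * h) - 1) / h) y = rs (exp (m * h) / h) y - rs (1 / h) y"
      by (simp add: diff_divide_distrib scale_left_diff_distrib)
    then show ?thesis by (simp add: scale_right_diff_distrib)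
  qed
  have "tends (\<lambda>h. rs (exp (m * h)) (rs (1 / h) (f h - y)) + rs ((exp (m * h) - 1) / h) y)
      (sm 1 z + rs m y) (at_right 0)"
    by (intro tends_add tends_scale assms 1 2 tends_const)
  then show ?thesis unfolding eq by simp
qed

interpretation M: maccretive sm ip D "\<lambda>x. G x + rs \<mu> x"
  by (rule maccretive_shift)

text \<open>\<open>M.T\<close> belongs to G + \<mu>; the exponential factor removes this
  shift.\<close>

definition semi :: "real \<Rightarrow> 'a \<Rightarrow> 'a" where
  "semi t y = rs (exp (\<mu> * t)) (M.T t y)"

lemma semi_lin: "t \<ge> 0 \<Longrightarrow> lin_on sm sm UNIV (semi t)"
  by (simp add: lin_on_def subspace_on_def semi_def M.T_add M.T_scale scale_right_distrib mult.commute)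

lemma semi_zero: "semi 0 y = y"
  by (simp add: semi_def M.T_zero)

lemma semi_plus: "s \<ge> 0 \<Longrightarrow> t \<ge> 0 \<Longrightarrow> semi (s + t) y = semi s (semi t y)"
  by (simp add: semi_def M.T_plus M.T_scale distrib_left exp_add)

text \<open>For \<nu> \<le> \<mu> the shifted operator G + \<mu> has the margin \<mu> - \<nu>, whose
  decay corrects the factor exp (\<mu> t). For larger \<nu> contractivity of \<open>M.T\<close> is
  enough.\<close>

lemma semi_nm_le:
  assumes low: "\<And>x. x \<in> D \<Longrightarrow> Re (ip x (G x)) \<ge> - \<nu> * (nm x)\<^sup>2" and t: "t \<ge> 0"
  shows "nm (semi t y) \<le> exp (\<nu> * t) * nm y"
proof (cases "\<nu> \<le> \<mu>")
  case True
  have "nm (M.T t y) \<le> exp (- (\<mu> - \<nu>) * t) * nm y"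
  proof (rule M.T_nm_le_exp)
    show "(\<mu> - \<nu>) * (nm x)\<^sup>2 \<le> Re (ip x (G x + rs \<mu> x))" if "x \<in> D" for x
      using low[OF that] by (simp add: ip_add_right ip_scale_right nm_square algebra_simps)
  qed (use True t in auto)
  then have "nm (semi t y) \<le> exp (\<mu> * t) * (exp (- (\<mu> - \<nu>) * t) * nm y)"
    by (simp add: semi_def nm_scale_real)
  also have "\<dots> = exp (\<nu> * t) * nm y"
    by (simp add: mult.assoc[symmetric] exp_add[symmetric] algebra_simps)
  finally show ?thesis .
next
  case False
  have "nm (semi t y) \<le> exp (\<mu> * t) * nm y"
    using M.T_nm_le[OF t] by (simp add: semi_def nm_scale_real)
  also have "\<dots> \<le> exp (\<nu> * t) * nm y"
    using False t by (intro mult_right_mono) (auto intro: mult_right_mono)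
  finally show ?thesis .
qed

lemma semi_continuous:
  assumes "t0 \<ge> 0" shows "tends (\<lambda>t. semi t y) (semi t0 y) (at t0 within {0..})"
  unfolding semi_def by (intro tends_scale M.T_continuous assms tendsto_intros)

lemma semi_derivative:
  assumes "x \<in> D" shows "tends (\<lambda>h. rs (1 / h) (semi h x - x)) (- G x) (at_right 0)"
  using tends_rescaled_quotient[OF M.T_derivative[OF assms], of \<mu>] by (simp add: semi_def)

lemma semi_derivative_domain:
  assumes "tends (\<lambda>h. rs (1 / h) (semi h y - y)) z (at_right 0)" shows "y \<in> D"
proof -
  have "rs (exp (- \<mu> * h)) (semi h y) = M.T h y" for h
    by (simp add: semi_def exp_minus flip: of_real_mult)
  then have "tends (\<lambda>h. rs (1 / h) (M.T h y - y)) (z + rs (- \<mu>) y) (at_right 0)"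
    using tends_rescaled_quotient[OF assms, of "- \<mu>"] by simp
  then show ?thesis by (rule M.T_derivative_domain)
qed

end

section \<open>Surjectivity of strictly positive self-adjoint operators\<close>

text \<open>The first-order condition at a minimum. The denominator \<beta> + 1 in place of \<beta>
  also covers \<beta> = 0.\<close>

lemma linear_coeff_eq_0:
  fixes \<alpha> \<beta> :: real
  assumes "\<And>s. 2 * s * \<alpha> + s\<^sup>2 * \<beta> \<ge> 0" "\<beta> \<ge> 0"
  shows "\<alpha> = 0"
proof (rule ccontr)
  assume "\<alpha> \<noteq> 0"
  define s where "s = - \<alpha> / (\<beta> + 1)"
  have p: "\<beta> + 1 > 0" using assms(2) by simp
  have \<alpha>: "\<alpha> = - s * (\<beta> + 1)" using p by (simp add: s_def)
  have "s \<noteq> 0" using \<open>\<alpha> \<noteq> 0\<close> \<alpha> by auto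
  have "2 * s * \<alpha> + s\<^sup>2 * \<beta> = - (s\<^sup>2 * (\<beta> + 2))"
    unfolding \<alpha> by (simp add: power2_eq_square algebra_simps)
  moreover have "s\<^sup>2 * (\<beta> + 2) > 0" using \<open>s \<noteq> 0\<close> assms(2) by simp
  ultimately show False using assms(1)[of s] by linarith
qed

context chilbert begin

text \<open>Symmetry passes to the limit and exhibits x as an element of the domain of the adjoint,
  which is \<open>D\<close>; density then identifies A x.\<close>

lemma self_adjoint_closed:
  assumes sa: "self_adjoint sm ip D A" and f: "\<And>n::nat. f n \<in> D"
    and "tends f x sequentially" "tends (\<lambda>n. A (f n)) p sequentially"
  shows "x \<in> D \<and> A x = p"
proof -
  have sym: "ip (A v) u = ip v (A u)" if "v \<in> D" "u \<in> D" for u v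
    using sa that unfolding self_adjoint_def by blast
  have *: "ip (A v) x = ip v p" if "v \<in> D" for v
  proof (rule LIMSEQ_unique)
    show "(\<lambda>n. ip (A v) (f n)) \<longlonglongrightarrow> ip (A v) x" by (intro tends_ip_right assms)
    show "(\<lambda>n. ip (A v) (f n)) \<longlonglongrightarrow> ip v p"
      using tends_ip_right[OF assms(4), of v] sym[OF that f] by simp
  qed
  then have x: "x \<in> D" using sa unfolding self_adjoint_def by blast
  have "dense_in ip D" using sa unfolding self_adjoint_def by blast
  then have "A x - p = 0"
    by (rule dense_orthogonal_imp_zero) (simp add: ip_diff_right * flip: sym[OF _ x])
  then show ?thesis using x by simp
qed

text \<open>The distance from y to the range is minimised. The lower bound makes a minimising
  sequence converge together with its images, and closedness gives a minimiser. Its residual is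
  orthogonal to the range, hence lies in the domain of the adjoint, and strict positivity kills
  it.\<close>

lemma self_adjoint_surj:
  assumes sa: "self_adjoint sm ip D A" and eps: "\<epsilon> > 0"
    and pos: "\<And>x. x \<in> D \<Longrightarrow> Re (ip x (A x)) \<ge> \<epsilon> * (nm x)\<^sup>2"
  shows "\<exists>x\<in>D. A x = y"
proof -
  interpret linear_operator sm ip D A
    using sa unfolding self_adjoint_def by unfold_locales blast
  have low: "\<epsilon> * nm x \<le> nm (A x)" if "x \<in> D" for x
  proof (cases "nm x = 0")
    case False
    then have p: "nm x > 0" using nm_nonneg[of x] by linarith
    have "\<epsilon> * nm x * nm x \<le> Re (ip x (A x))"
      using pos[OF that] by (simp add: power2_eq_square)
    also have "\<dots> \<le> nm x * nm (A x)"
      using complex_Re_le_cmod Cauchy_Schwarz order_trans by blast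
    finally show ?thesis using p by (simp add: mult.commute mult_left_le_imp_le)
  qed simp
  define d where "d = (INF x\<in>D. (nm (A x - y))\<^sup>2)"
  have bb: "bdd_below ((\<lambda>x. (nm (A x - y))\<^sup>2) ` D)"
    by (rule bdd_belowI[of _ 0]) auto
  have d_le: "d \<le> (nm (A x - y))\<^sup>2" if "x \<in> D" for x
    unfolding d_def using bb that by (rule cINF_lower)
  have "\<exists>x\<in>D. (nm (A x - y))\<^sup>2 < d + 1 / real (Suc n)" for n
  proof -
    have "d < d + 1 / real (Suc n)" by simp
    then show ?thesis using cINF_less_iff[OF _ bb, of "d + 1 / real (Suc n)"] D_zero
      unfolding d_def[symmetric] by auto
  qed
  then obtain f where f: "\<And>n. f n \<in> D" "\<And>n. (nm (A (f n) - y))\<^sup>2 < d + 1 / real (Suc n)"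
    by metis
  have close: "(nm (A (f m) - A (f n)))\<^sup>2 \<le> 2 / real (Suc m) + 2 / real (Suc n)" for m n
  proof -
    \<comment> \<open>The image of the midpoint still has squared distance at least \<open>d\<close>
      from y, so the parallelogram law bounds the distance between two nearly optimal
      images.\<close>
    define u where "u = rs (1 / 2) (f m + f n)"
    have u: "u \<in> D" using f by (simp add: u_def D_add D_scale)
    have Au: "A u = rs (1 / 2) (A (f m) + A (f n))" by (simp only: u_def G_add G_scale f D_add)
    have "rs 2 y = y + y" using scale_left_distrib[of 1 1 y] by simp
    then have "rs 2 (A u - y) = (A (f m) - y) + (A (f n) - y)"
      unfolding Au by (simp add: scale_right_diff_distrib)
    then have "nm ((A (f m) - y) + (A (f n) - y)) = 2 * nm (A u - y)"
      using nm_scale_real[of 2 "A u - y"] by simp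
    then have "(nm ((A (f m) - y) + (A (f n) - y)))\<^sup>2 \<ge> 4 * d"
      using d_le[OF u] by (simp add: power_mult_distrib)
    moreover have "(nm ((A (f m) - y) - (A (f n) - y)))\<^sup>2 = (nm (A (f m) - A (f n)))\<^sup>2" by simp
    ultimately show ?thesis
      using parallelogram[of "A (f m) - y" "A (f n) - y"] f(2)[of m] f(2)[of n] by linarith
  qed
  have small: "\<exists>N. \<forall>m\<ge>N. \<forall>n\<ge>N. nm (A (f m) - A (f n)) < e" if e: "e > 0" for e
  proof -
    obtain N where N: "1 / real (Suc N) < e\<^sup>2 / 4"
      using nat_approx_posE[of "e\<^sup>2 / 4"] e by auto
    have "nm (A (f m) - A (f n)) < e" if "m \<ge> N" "n \<ge> N" for m n
    proof -
      have "1 / real (Suc m) \<le> 1 / real (Suc N)" "1 / real (Suc n) \<le> 1 / real (Suc N)"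
        using that by (auto intro!: divide_left_mono)
      then have "(nm (A (f m) - A (f n)))\<^sup>2 < e\<^sup>2" using close[of m n] N by simp
      then show ?thesis using e by (simp add: power2_less_imp_less)
    qed
    then show ?thesis by blast
  qed
  then have "\<exists>p. tends (\<lambda>n. A (f n)) p sequentially" by (rule complete)
  then obtain p where p: "tends (\<lambda>n. A (f n)) p sequentially" by blast
  have "\<exists>x. tends f x sequentially"
  proof (rule complete)
    fix e :: real assume e: "e > 0"
    obtain N where N: "\<And>m n. m \<ge> N \<Longrightarrow> n \<ge> N \<Longrightarrow> nm (A (f m) - A (f n)) < \<epsilon> * e"
      using small[of "\<epsilon> * e"] e eps by auto
    have "nm (f m - f n) < e" if "m \<ge> N" "n \<ge> N" for m n
    proof -
      have "\<epsilon> * nm (f m - f n) < \<epsilon> * e"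
        using low[OF D_diff[OF f(1)[of m] f(1)[of n]]] N[OF that] by (simp add: G_diff f)
      then show ?thesis using eps by simp
    qed
    then show "\<exists>N. \<forall>m\<ge>N. \<forall>n\<ge>N. nm (f m - f n) < e" by blast
  qed
  then obtain x where "tends f x sequentially" by blast
  then have x: "x \<in> D" "A x = p" using self_adjoint_closed[OF sa f(1) _ p] by auto
  define w where "w = A x - y"
  have w_d: "(nm w)\<^sup>2 \<le> d"
  proof (rule LIMSEQ_le)
    show "(\<lambda>n. (nm (A (f n) - y))\<^sup>2) \<longlonglongrightarrow> (nm w)\<^sup>2"
      unfolding w_def x by (intro tendsto_power tends_nm tends_diff p tends_const)
    have "(\<lambda>n. d + 1 / real (Suc n)) \<longlonglongrightarrow> d + 0"
      by (intro tendsto_add tendsto_const LIMSEQ_Suc lim_1_over_n)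
    then show "(\<lambda>n. d + 1 / real (Suc n)) \<longlonglongrightarrow> d" by simp
    show "\<exists>N. \<forall>n\<ge>N. (nm (A (f n) - y))\<^sup>2 \<le> d + 1 / real (Suc n)"
      using f(2) less_imp_le by blast
  qed
  have Re0: "Re (ip w (A v)) = 0" if v: "v \<in> D" for v
  proof (rule linear_coeff_eq_0)
    fix s :: real
    have "(nm w)\<^sup>2 \<le> (nm (A (x + rs s v) - y))\<^sup>2"
      using w_d d_le[OF D_add[OF x(1) D_scale[OF v]]] order_trans by blast
    also have "A (x + rs s v) - y = w + rs s (A v)"
      by (simp add: w_def G_add G_scale x(1) v D_scale)
    also have "(nm \<dots>)\<^sup>2 = (nm w)\<^sup>2 + (2 * s * Re (ip w (A v)) + s\<^sup>2 * (nm (A v))\<^sup>2)"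
      by (simp add: nm_add_square ip_scale_right nm_scale_real power_mult_distrib)
    finally show "2 * s * Re (ip w (A v)) + s\<^sup>2 * (nm (A v))\<^sup>2 \<ge> 0" by simp
  qed simp
  have orth: "ip (A v) w = 0" if v: "v \<in> D" for v
  proof -
    \<comment> \<open>Testing with \<i> times v turns the real part into the imaginary part.\<close>
    have "Im (ip w (A v)) = 0"
      using Re0[OF D_scale[OF v, of \<i>]] by (simp add: G_scale v ip_scale_right)
    then have "ip w (A v) = 0" using Re0[OF v] by (simp add: complex_eq_iff)
    then show ?thesis using ip_cnj[of "A v" w] by simp
  qed
  \<comment> \<open>The zero vector is the witness required by the description of the adjoint
    domain.\<close>
  have "\<forall>v\<in>D. ip (A v) w = ip v 0" by (simp add: orth)
  then have w: "w \<in> D" using sa unfolding self_adjoint_def by blast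
  have "ip w (A w) = 0" using orth[OF w] ip_cnj[of w "A w"] by simp
  then have "\<epsilon> * (nm w)\<^sup>2 \<le> 0" using pos[OF w] by simp
  then have "w = 0" using eps by (simp add: mult_le_0_iff)
  then have "A x = y" by (simp add: w_def)
  then show ?thesis using x(1) by blast
qed

lemma self_adjoint_plus_real:
  assumes sa: "self_adjoint sm ip D A"
  shows "self_adjoint sm ip D (\<lambda>x. A x + sm (complex_of_real k) x)"
  unfolding self_adjoint_def
proof (intro conjI allI)
  show "dense_in ip D" using sa by (simp add: self_adjoint_def)
  show "lin_on sm sm D (\<lambda>x. A x + sm (complex_of_real k) x)"
  proof -
    have "lin_on sm sm D A" using sa unfolding self_adjoint_def by blast
    then show ?thesis
      by (auto simp: lin_on_def scale_right_distrib mult.commute algebra_simps)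
  qed
  show "\<forall>x\<in>D. \<forall>y\<in>D. ip (A x + sm (complex_of_real k) x) y = ip x (A y + sm (complex_of_real k) y)"
  proof -
    have "\<forall>x\<in>D. \<forall>y\<in>D. ip (A x) y = ip x (A y)" using sa unfolding self_adjoint_def by blast
    then show ?thesis by (simp add: ip_simps)
  qed
  fix y
  have iff: "y \<in> D \<longleftrightarrow> (\<exists>z. \<forall>x\<in>D. ip (A x) y = ip x z)" using sa unfolding self_adjoint_def by blast
  also have "\<dots> \<longleftrightarrow> (\<exists>z. \<forall>x\<in>D. ip (A x + sm (complex_of_real k) x) y = ip x z)"
  proof
    assume "\<exists>z. \<forall>x\<in>D. ip (A x) y = ip x z"
    then obtain z where "\<forall>x\<in>D. ip (A x) y = ip x z" by blast
    then have "\<forall>x\<in>D. ip (A x + sm (complex_of_real k) x) y = ip x (z + sm (complex_of_real k) y)"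
      by (simp add: ip_simps)
    then show "\<exists>z. \<forall>x\<in>D. ip (A x + sm (complex_of_real k) x) y = ip x z" by blast
  next
    assume "\<exists>z. \<forall>x\<in>D. ip (A x + sm (complex_of_real k) x) y = ip x z"
    then obtain z where "\<forall>x\<in>D. ip (A x + sm (complex_of_real k) x) y = ip x z" by blast
    then have "\<forall>x\<in>D. ip (A x) y = ip x (z - sm (complex_of_real k) y)"
      by (simp add: ip_simps eq_diff_eq)
    then show "\<exists>z. \<forall>x\<in>D. ip (A x) y = ip x z" by blast
  qed
  finally show "y \<in> D \<longleftrightarrow> (\<exists>z. \<forall>x\<in>D. ip (A x + sm (complex_of_real k) x) y = ip x z)" .
qed

end

section \<open>The energy space\<close>

definition prod_ip :: "('a \<Rightarrow> 'a \<Rightarrow> complex) \<Rightarrow> 'a \<times> 'a \<Rightarrow> 'a \<times> 'a \<Rightarrow> complex" where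
  "prod_ip ip x y = ip (fst x) (fst y) + ip (snd x) (snd y)"

context chilbert begin

lemma hnorm_prod: "hnorm (prod_ip ip) v = sqrt ((nm (fst v))\<^sup>2 + (nm (snd v))\<^sup>2)"
  by (simp add: hnorm_def prod_ip_def ip_self_nonneg)

lemma hnorm_prod_le: "hnorm (prod_ip ip) v \<le> nm (fst v) + nm (snd v)"
  unfolding hnorm_prod by (rule sqrt_sum_squares_le_sum) auto

lemma prod_hilbert: "complex_hilbert (psmul sm) (prod_ip ip)"
  unfolding complex_hilbert_def
proof (intro conjI allI impI)
  fix a b and x y z :: "'a \<times> 'a"
  show "psmul sm a (x + y) = psmul sm a x + psmul sm a y"
    and "psmul sm (a + b) x = psmul sm a x + psmul sm b x"
    and "psmul sm a (psmul sm b x) = psmul sm (a * b) x"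
    and "psmul sm 1 x = x"
    by (simp_all add: psmul_def scale_right_distrib scale_left_distrib)
  show "prod_ip ip x (y + z) = prod_ip ip x y + prod_ip ip x z"
    and "prod_ip ip x (psmul sm a y) = a * prod_ip ip x y"
    by (simp_all add: prod_ip_def psmul_def ip_simps distrib_left)
  show "prod_ip ip y x = cnj (prod_ip ip x y)"
    by (simp add: prod_ip_def ip_cnj[of "fst y" "fst x"] ip_cnj[of "snd y" "snd x"])
  show "0 \<le> Re (prod_ip ip x x)" by (simp add: prod_ip_def ip_self_nonneg)
  show "x = 0" if "prod_ip ip x x = 0"
  proof -
    have "(nm (fst x))\<^sup>2 + (nm (snd x))\<^sup>2 = 0"
      using arg_cong[OF that, of Re] by (simp add: prod_ip_def nm_square)
    then show ?thesis by (simp add: sum_power2_eq_zero_iff prod_eq_iff)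
  qed
next
  fix f :: "nat \<Rightarrow> 'a \<times> 'a"
  assume C: "\<forall>e>0. \<exists>N. \<forall>m\<ge>N. \<forall>n\<ge>N. hnorm (prod_ip ip) (f m - f n) < e"
  have le: "nm (fst v) \<le> hnorm (prod_ip ip) v" "nm (snd v) \<le> hnorm (prod_ip ip) v" for v
    unfolding hnorm_prod by (simp_all add: real_le_rsqrt)
  have "\<exists>l. tends (\<lambda>n. fst (f n)) l sequentially"
    by (rule complete) (metis C le(1) fst_diff le_less_trans)
  then obtain l where l: "tends (\<lambda>n. fst (f n)) l sequentially" by blast
  have "\<exists>m. tends (\<lambda>n. snd (f n)) m sequentially"
    by (rule complete) (metis C le(2) snd_diff le_less_trans)
  then obtain m where m: "tends (\<lambda>n. snd (f n)) m sequentially" by blast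
  have "(\<lambda>n. hnorm (prod_ip ip) (f n - (l, m))) \<longlonglongrightarrow> 0"
  proof (rule tendsto_sandwich[OF _ _ tendsto_const])
    show "(\<lambda>n. nm (fst (f n) - l) + nm (snd (f n) - m)) \<longlonglongrightarrow> 0"
      using tendsto_add[OF l[unfolded tends_def] m[unfolded tends_def]] by simp
    show "eventually (\<lambda>n. hnorm (prod_ip ip) (f n - (l, m)) \<le> nm (fst (f n) - l) + nm (snd (f n) - m)) sequentially"
      using hnorm_prod_le[of "f n - (l, m)" for n] by simp
    show "eventually (\<lambda>n. 0 \<le> hnorm (prod_ip ip) (f n - (l, m))) sequentially"
      by (simp add: hnorm_prod)
  qed
  then show "\<exists>l. (\<lambda>n. hnorm (prod_ip ip) (f n - l)) \<longlonglongrightarrow> 0" by blast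
qed

end

section \<open>The square root and the elliptic equation\<close>

locale damped_wave = chilbert smul ip
  for smul :: "complex \<Rightarrow> 'a::ab_group_add \<Rightarrow> 'a" and ip :: "'a \<Rightarrow> 'a \<Rightarrow> complex" +
  fixes DA DS :: "'a set"
    and A S B C :: "'a \<Rightarrow> 'a"
    and \<epsilon> a b c d :: real
  assumes A_sa: "self_adjoint smul ip DA A"
    and eps: "\<epsilon> > 0" and A_pos: "\<forall>x\<in>DA. Re (ip x (A x)) \<ge> \<epsilon> * Re (ip x x)"
    and S_sqrt: "pos_sqrt smul ip DA A DS S"
    and B_lin: "lin_on smul smul DS B"
    and B_bd: "\<forall>x\<in>DS. (hnorm ip (B x))\<^sup>2 \<le> a\<^sup>2 * (hnorm ip (S x))\<^sup>2 + b\<^sup>2 * (hnorm ip x)\<^sup>2"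
    and a_rng: "0 \<le> a" "a < 1"
    and B_sym_or_bdd: "(\<forall>x\<in>DS. \<forall>y\<in>DS. ip (B x) y = ip x (B y)) \<or>
                       (\<exists>K. \<forall>x\<in>DS. hnorm ip (B x) \<le> K * hnorm ip x)"
    and C_lin: "lin_on smul smul DS C"
    and C_bd: "\<forall>x\<in>DS. (hnorm ip (C x))\<^sup>2 \<le> c\<^sup>2 * (hnorm ip (S x))\<^sup>2 + d\<^sup>2 * (hnorm ip x)\<^sup>2"
begin

lemma S_sa: "self_adjoint smul ip DS S"
  and DA_iff: "x \<in> DA \<longleftrightarrow> x \<in> DS \<and> S x \<in> DS"
  and SS: "x \<in> DA \<Longrightarrow> S (S x) = A x"
  using S_sqrt unfolding pos_sqrt_def by auto

lemma S_sym: "x \<in> DS \<Longrightarrow> y \<in> DS \<Longrightarrow> ip (S x) y = ip x (S y)"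
  using S_sa unfolding self_adjoint_def by blast

sublocale S: linear_operator smul ip DS S
  using S_sa unfolding self_adjoint_def by unfold_locales blast

sublocale A: linear_operator smul ip DA A
  using A_sa unfolding self_adjoint_def by unfold_locales blast

sublocale B: linear_operator smul ip DS B
  by unfold_locales (rule B_lin)

sublocale C: linear_operator smul ip DS C
  by unfold_locales (rule C_lin)

abbreviation rs :: "real \<Rightarrow> 'a \<Rightarrow> 'a" where "rs h \<equiv> smul (complex_of_real h)"

lemma A_shift_surj:
  assumes "k \<ge> 0" shows "\<exists>x\<in>DA. A x + rs k x = y"
proof (rule self_adjoint_surj[OF self_adjoint_plus_real[OF A_sa] eps])
  fix x assume "x \<in> DA"
  then have "\<epsilon> * (nm x)\<^sup>2 \<le> Re (ip x (A x))" using A_pos by (simp add: nm_square)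
  moreover have "0 \<le> k * (nm x)\<^sup>2" using assms by simp
  ultimately show "\<epsilon> * (nm x)\<^sup>2 \<le> Re (ip x (A x + rs k x))"
    by (simp add: ip_add_right ip_scale_right nm_square)
qed

lemma S_surj: "\<exists>x\<in>DS. S x = y"
proof -
  obtain x where x: "x \<in> DA" "A x = y" using A_shift_surj[of 0 y] by auto
  then show ?thesis using DA_iff SS by blast
qed

text \<open>Positivity of A is given on \<open>DA\<close> only. Writing x = S u puts u into
  \<open>DA\<close> with A u = S x, whence \<epsilon> |u|^2 \<le> |x|^2 and |x|^2 = <u|S x> \<le>
  |u| |S x|. Eliminating u gives the bound on all of \<open>DS\<close>.\<close>

lemma S_lower_bound:
  assumes x: "x \<in> DS" shows "\<epsilon> * (nm x)\<^sup>2 \<le> (nm (S x))\<^sup>2"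
proof -
  obtain u where u: "u \<in> DS" "S u = x" using S_surj by blast
  then have uA: "u \<in> DA" "A u = S x" using x DA_iff SS by auto
  have "Re (ip u (A u)) = (nm x)\<^sup>2"
    using S_sym[of u x] u x uA by (simp add: nm_square)
  then have 1: "\<epsilon> * (nm u)\<^sup>2 \<le> (nm x)\<^sup>2" "(nm x)\<^sup>2 \<le> nm u * nm (S x)"
    using A_pos uA Cauchy_Schwarz[of u "S x"] complex_Re_le_cmod[of "ip u (S x)"]
    by (auto simp: nm_square[symmetric])
  have "\<epsilon> * ((nm x)\<^sup>2 * (nm x)\<^sup>2) \<le> \<epsilon> * ((nm u * nm (S x)) * (nm u * nm (S x)))"
    using eps 1(2) by (intro mult_left_mono mult_mono) auto
  also have "\<dots> = (\<epsilon> * (nm u)\<^sup>2) * (nm (S x))\<^sup>2" by (simp add: power2_eq_square)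
  also have "\<dots> \<le> (nm x)\<^sup>2 * (nm (S x))\<^sup>2" using 1(1) by (intro mult_right_mono) auto
  finally have "(nm x)\<^sup>2 * (\<epsilon> * (nm x)\<^sup>2) \<le> (nm x)\<^sup>2 * (nm (S x))\<^sup>2" by (simp add: mult_ac)
  then show ?thesis by (cases "nm x = 0") (simp_all add: mult_le_cancel_left)
qed

lemma S_inj: "x \<in> DS \<Longrightarrow> y \<in> DS \<Longrightarrow> S x = S y \<Longrightarrow> x = y"
proof -
  assume "x \<in> DS" "y \<in> DS" "S x = S y"
  then have "\<epsilon> * (nm (x - y))\<^sup>2 \<le> 0"
    using S_lower_bound[of "x - y"] by (simp add: S.D_diff S.G_diff)
  then show "x = y" using eps by (simp add: mult_le_0_iff)
qed

definition R :: "'a \<Rightarrow> 'a" where "R y = (THE x. x \<in> DS \<and> S x = y)"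

lemma R_S: "x \<in> DS \<Longrightarrow> R (S x) = x"
  unfolding R_def using S_inj by blast

lemma R_DS: "R y \<in> DS" and S_R: "S (R y) = y"
  using S_surj[of y] R_S by auto

lemma R_add: "R (x + y) = R x + R y"
  using R_S[OF S.D_add[OF R_DS[of x] R_DS[of y]]] by (simp add: S.G_add R_DS S_R)

lemma R_scale: "R (smul k x) = smul k (R x)"
  using R_S[OF S.D_scale[OF R_DS[of x], of k]] by (simp add: S.G_scale R_DS S_R)

lemma R_DA_iff: "R v \<in> DA \<longleftrightarrow> v \<in> DS"
  by (simp add: DA_iff R_DS S_R)

lemma A_shift_norm:
  assumes "x \<in> DA"
  shows "(nm (A x + rs (l\<^sup>2) x))\<^sup>2 = (nm (A x))\<^sup>2 + 2 * l\<^sup>2 * (nm (S x))\<^sup>2 + l ^ 4 * (nm x)\<^sup>2"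
proof -
  have x: "x \<in> DS" "S x \<in> DS" using assms DA_iff by auto
  have "ip (A x) x = ip (S x) (S x)"
    using SS[OF assms] S_sym[OF x(2,1)] by simp
  then have "Re (ip (A x) (rs (l\<^sup>2) x)) = l\<^sup>2 * (nm (S x))\<^sup>2"
    by (simp add: ip_scale_right nm_square del: of_real_power)
  then show ?thesis
    by (simp add: nm_add_square nm_scale_real power_mult_distrib del: of_real_power)
qed

text \<open>For l > L0 the perturbation l B is dominated by 3/4, and C by 1/10, of A + l^2.\<close>

definition L0 :: real where "L0 = 1 + 2 * b\<^sup>2 + 50 * c\<^sup>2 + 100 * d\<^sup>2"

text \<open>The part of the square of \<open>l * nm (B x)\<close> that involves S x is at most half
  of the cross term in \<open>A_shift_norm\<close>, and the part with b is at most half of the last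
  term. This gives N^2 / 2, and 1/2 < 9/16 explains the factor 3/4.\<close>

lemma elliptic_surj:
  assumes l: "l > L0" and s: "cmod s = 1"
  shows "\<exists>x\<in>DA. (A x + rs (l\<^sup>2) x) + (smul (s * \<i> * of_real l) (B x) + C x) = g"
proof (rule relatively_bounded_perturbation_surj)
  have sub: "x \<in> DS" if "x \<in> DA" for x using that DA_iff by auto
  show "x - y \<in> DA" if "x \<in> DA" "y \<in> DA" for x y using that by (rule A.D_diff)
  show "A (x - y) + rs (l\<^sup>2) (x - y) = A x + rs (l\<^sup>2) x - (A y + rs (l\<^sup>2) y)"
    if "x \<in> DA" "y \<in> DA" for x y
    using that by (simp add: A.G_diff scale_right_diff_distrib)
  show "\<exists>x\<in>DA. A x + rs (l\<^sup>2) x = y" for y by (rule A_shift_surj) simp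
  show "smul (s * \<i> * of_real l) (B (x - y)) + C (x - y) =
      smul (s * \<i> * of_real l) (B x) + C x - (smul (s * \<i> * of_real l) (B y) + C y)"
    if "x \<in> DA" "y \<in> DA" for x y
    using that sub by (simp add: B.G_diff C.G_diff scale_right_diff_distrib)
  show "nm (smul (s * \<i> * of_real l) (B x) + C x) \<le> (17 / 20) * nm (A x + rs (l\<^sup>2) x)"
    if x: "x \<in> DA" for x
  proof -
    have xS: "x \<in> DS" using x by (rule sub)
    have nn: "b\<^sup>2 \<ge> 0" "c\<^sup>2 \<ge> 0" "d\<^sup>2 \<ge> 0" by auto
    \<comment> \<open>Each summand of \<open>L0\<close> serves one estimate: since 1 \<le> l, a
      bound of a constant by a multiple of l is also one by the same multiple of l^2 and of
      l^4.\<close>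
    have l1: "l \<ge> 1" "l \<ge> 2 * b\<^sup>2" "l \<ge> 50 * c\<^sup>2" "l \<ge> 100 * d\<^sup>2" using l nn unfolding L0_def by linarith+
    have l2: "l \<le> l\<^sup>2" "l\<^sup>2 \<le> l ^ 4" using l1 power_increasing[of 1 2 l] power_increasing[of 2 4 l] by auto
    define N where "N = nm (A x + rs (l\<^sup>2) x)"
    have N: "2 * l\<^sup>2 * (nm (S x))\<^sup>2 + l ^ 4 * (nm x)\<^sup>2 \<le> N\<^sup>2"
      unfolding N_def A_shift_norm[OF x] by simp
    have a1: "a\<^sup>2 \<le> 1" using a_rng by (simp add: power_le_one)
    have "(l * nm (B x))\<^sup>2 \<le> l\<^sup>2 * (a\<^sup>2 * (nm (S x))\<^sup>2 + b\<^sup>2 * (nm x)\<^sup>2)"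
      unfolding power_mult_distrib using B_bd xS by (intro mult_left_mono) auto
    also have "\<dots> = (l\<^sup>2 * (nm (S x))\<^sup>2) * a\<^sup>2 + (l\<^sup>2 * (nm x)\<^sup>2) * b\<^sup>2"
      by (simp add: algebra_simps)
    also have "\<dots> \<le> (l\<^sup>2 * (nm (S x))\<^sup>2) * 1 + (l\<^sup>2 * (nm x)\<^sup>2) * (l\<^sup>2 / 2)"
      using a1 l1 l2 by (intro add_mono mult_left_mono) auto
    also have "\<dots> = (2 * l\<^sup>2 * (nm (S x))\<^sup>2 + l ^ 4 * (nm x)\<^sup>2) / 2"
      by (simp add: power2_eq_square power4_eq_xxxx)
    also have "\<dots> \<le> N\<^sup>2 / 2" using N by simp
    also have "\<dots> \<le> (3 / 4 * N)\<^sup>2" by (simp add: power_mult_distrib power_divide)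
    finally have 1: "l * nm (B x) \<le> 3 / 4 * N"
      by (rule power2_le_imp_le) (simp add: N_def)
    have "(nm (C x))\<^sup>2 \<le> c\<^sup>2 * (nm (S x))\<^sup>2 + d\<^sup>2 * (nm x)\<^sup>2" using C_bd xS by blast
    also have "\<dots> \<le> (l\<^sup>2 / 50) * (nm (S x))\<^sup>2 + (l ^ 4 / 100) * (nm x)\<^sup>2"
      using l1 l2 by (intro add_mono mult_right_mono) auto
    also have "\<dots> = (2 * l\<^sup>2 * (nm (S x))\<^sup>2 + l ^ 4 * (nm x)\<^sup>2) / 100" by simp
    also have "\<dots> \<le> N\<^sup>2 / 100" using N by simp
    also have "\<dots> = (1 / 10 * N)\<^sup>2" by (simp add: power_mult_distrib power_divide)
    finally have 2: "nm (C x) \<le> 1 / 10 * N"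
      by (rule power2_le_imp_le) (simp add: N_def)
    have "nm (smul (s * \<i> * of_real l) (B x)) = l * nm (B x)"
      using s l1 by (simp add: nm_scale norm_mult)
    then have "nm (smul (s * \<i> * of_real l) (B x) + C x) \<le> l * nm (B x) + nm (C x)"
      using nm_triangle by metis
    then show ?thesis using 1 2 by (simp add: N_def)
  qed
qed simp_all

end

section \<open>Energy estimate and range of the generator\<close>

context damped_wave begin

abbreviation G0 :: "'a \<times> 'a \<Rightarrow> 'a \<times> 'a" where "G0 \<equiv> Gplus smul A B C"

lemma G0_eq: "G0 y = (- snd y, A (fst y) + smul \<i> (B (snd y)) + C (fst y))"
  by (simp add: Gplus_def psmul_def Hop_def Bhat_def Vop_def scale_right_distrib scale_right_diff_distrib)

lemma energy_bound:
  "\<exists>\<mu>. \<forall>x\<in>DH DA DS. \<bar>Re (yip ip S x (G0 x))\<bar> \<le> \<mu> * ((nm (S (fst x)))\<^sup>2 + (nm (snd x))\<^sup>2)"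
proof -
  have "\<exists>K\<ge>0. \<forall>y\<in>DS. \<bar>Im (ip y (B y))\<bar> \<le> K * (nm y)\<^sup>2"
    using B_sym_or_bdd
  proof
    assume sym: "\<forall>x\<in>DS. \<forall>y\<in>DS. ip (B x) y = ip x (B y)"
    have "Im (ip y (B y)) = 0" if "y \<in> DS" for y
      using sym that arg_cong[OF ip_cnj[of y "B y"], of Im] by simp
    then show ?thesis by (intro exI[of _ 0]) simp
  next
    assume "\<exists>K. \<forall>x\<in>DS. nm (B x) \<le> K * nm x"
    then obtain K where K: "\<And>x. x \<in> DS \<Longrightarrow> nm (B x) \<le> K * nm x" by blast
    have "\<bar>Im (ip y (B y))\<bar> \<le> \<bar>K\<bar> * (nm y)\<^sup>2" if "y \<in> DS" for y
    proof -
      have "\<bar>Im (ip y (B y))\<bar> \<le> nm y * nm (B y)"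
        using abs_Im_le_cmod Cauchy_Schwarz order_trans by blast
      also have "\<dots> \<le> nm y * (\<bar>K\<bar> * nm y)"
      proof (intro mult_left_mono)
        have "K * nm y \<le> \<bar>K\<bar> * nm y" by (intro mult_right_mono) auto
        then show "nm (B y) \<le> \<bar>K\<bar> * nm y" using K[OF that] by linarith
      qed simp
      finally show ?thesis by (simp add: power2_eq_square mult_ac)
    qed
    then show ?thesis by (intro exI[of _ "\<bar>K\<bar>"]) simp
  qed
  then obtain K where K: "K \<ge> 0" "\<And>y. y \<in> DS \<Longrightarrow> \<bar>Im (ip y (B y))\<bar> \<le> K * (nm y)\<^sup>2" by blast
  \<comment> \<open>The bound for C in terms of S alone: \<open>S_lower_bound\<close> absorbs the
    square of \<open>nm u\<close> at the cost of 1 / \<epsilon>.\<close>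
  define M where "M = c\<^sup>2 + d\<^sup>2 / \<epsilon>"
  have M: "M \<ge> 0" using eps by (simp add: M_def)
  have "\<bar>Re (yip ip S x (G0 x))\<bar> \<le> (K + 1 + M) * ((nm (S (fst x)))\<^sup>2 + (nm (snd x))\<^sup>2)"
    if x: "x \<in> DH DA DS" for x
  proof -
    define u v where "u = fst x" and "v = snd x"
    have uv: "u \<in> DA" "v \<in> DS" "u \<in> DS" "S u \<in> DS"
      using x DA_iff by (auto simp: DH_def u_def v_def)
    \<comment> \<open>The first component of \<open>G0 x\<close> contributes -<S u|S v>, whose real
      part cancels with that of <v|A u>. The skew wave part therefore drops out of the energy
      estimate.\<close>
    have "ip v (A u) = ip (S v) (S u)" using SS[OF uv(1)] S_sym[OF uv(2,4)] by simp
    then have "Re (ip v (A u)) = Re (ip (S u) (S v))"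
      using arg_cong[OF ip_cnj[of "S v" "S u"], of Re] by simp
    then have eq: "Re (yip ip S x (G0 x)) = - Im (ip v (B v)) + Re (ip v (C u))"
      using uv by (simp add: yip_def G0_eq ip_add_right ip_minus_right ip_scale_right S.G_minus
          flip: u_def v_def)
    have "(nm (C u))\<^sup>2 \<le> M * (nm (S u))\<^sup>2"
    proof -
      have "d\<^sup>2 * (nm u)\<^sup>2 = d\<^sup>2 / \<epsilon> * (\<epsilon> * (nm u)\<^sup>2)" using eps by simp
      also have "\<dots> \<le> d\<^sup>2 / \<epsilon> * (nm (S u))\<^sup>2"
        using eps by (intro mult_left_mono S_lower_bound uv) auto
      finally show ?thesis using C_bd uv(3) unfolding M_def by (force simp: distrib_right)
    qed
    moreover have "\<bar>Re (ip v (C u))\<bar> \<le> nm v * nm (C u)"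
      using abs_Re_le_cmod Cauchy_Schwarz order_trans by blast
    moreover have "2 * (nm v * nm (C u)) \<le> (nm v)\<^sup>2 + (nm (C u))\<^sup>2"
      using sum_squares_bound[of "nm v" "nm (C u)"] by simp
    moreover have "\<bar>Im (ip v (B v))\<bar> \<le> K * (nm v)\<^sup>2" by (intro K uv)
    moreover have "(K + 1 + M) * ((nm (S u))\<^sup>2 + (nm v)\<^sup>2)
        = K * (nm (S u))\<^sup>2 + (nm (S u))\<^sup>2 + M * (nm (S u))\<^sup>2 + K * (nm v)\<^sup>2 + (nm v)\<^sup>2 + M * (nm v)\<^sup>2"
      by (simp add: algebra_simps)
    moreover have "K * (nm (S u))\<^sup>2 \<ge> 0" "M * (nm v)\<^sup>2 \<ge> 0" "M * (nm (S u))\<^sup>2 \<ge> 0" "K * (nm v)\<^sup>2 \<ge> 0"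
      "(nm v)\<^sup>2 \<ge> 0" "(nm (S u))\<^sup>2 \<ge> 0" "nm v * nm (C u) \<ge> 0"
      using K(1) M by auto
    ultimately show ?thesis unfolding eq u_def[symmetric] v_def[symmetric] by linarith
  qed
  then show ?thesis by blast
qed

text \<open>The first row l x - s y = e is solved by y = s (l x - e), because s^2 = 1. Inserting
  this into the second row and multiplying by s leaves the equation of \<open>elliptic_surj\<close>
  for x.\<close>

lemma range_large_energy:
  assumes l: "l > L0" and s: "s = 1 \<or> s = (-1 :: complex)" and \<eta>: "\<eta> \<in> Yspace DS"
  shows "\<exists>\<xi>\<in>DH DA DS. psmul smul (of_real l) \<xi> + psmul smul s (G0 \<xi>) = \<eta>"
proof -
  define e f where "e = fst \<eta>" and "f = snd \<eta>"
  have e: "e \<in> DS" using \<eta> by (simp add: Yspace_def e_def)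
  have "cmod s = 1" using s by auto
  then obtain x where x: "x \<in> DA"
    "(A x + rs (l\<^sup>2) x) + (smul (s * \<i> * of_real l) (B x) + C x)
      = smul s f + smul (s * \<i>) (B e) + rs l e"
    using elliptic_surj[OF l] by blast
  have xS: "x \<in> DS" using x DA_iff by auto
  define y where "y = smul s (rs l x - e)"
  have y: "y \<in> DS" using xS e by (simp add: y_def S.D_diff S.D_scale)
  have By: "B y = smul s (rs l (B x) - B e)"
    using xS e by (simp add: y_def B.G_diff B.G_scale B.D_diff B.D_scale)
  have Ax: "A x = smul s f + smul (s * \<i>) (B e) + rs l e - rs (l\<^sup>2) x - smul (s * \<i> * of_real l) (B x) - C x"
    using x(2) by (simp add: algebra_simps)
  have "psmul smul (of_real l) (x, y) + psmul smul s (G0 (x, y)) = (e, f)"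
    using s by (auto simp: psmul_def G0_eq By Ax) (auto simp: y_def scale_right_distrib
      scale_right_diff_distrib power2_eq_square mult_ac)
  moreover have "(x, y) \<in> DH DA DS" using x y by (simp add: DH_def)
  ultimately show ?thesis by (auto simp: e_def f_def)
qed

section \<open>Unitary transport between the energy space and the full product\<close>

definition U :: "'a \<times> 'a \<Rightarrow> 'a \<times> 'a" where "U y = (S (fst y), snd y)"
definition Ui :: "'a \<times> 'a \<Rightarrow> 'a \<times> 'a" where "Ui v = (R (fst v), snd v)"
text \<open>The image of \<open>DH DA DS\<close> under \<open>U\<close>: as \<open>R v\<close> lies
  in \<open>DA\<close> exactly when v lies in \<open>DS\<close>, both components have the same
  domain.\<close>

definition DW :: "('a \<times> 'a) set" where "DW = {v. fst v \<in> DS \<and> snd v \<in> DS}"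
definition GW :: "complex \<Rightarrow> 'a \<times> 'a \<Rightarrow> 'a \<times> 'a" where "GW s v = U (psmul smul s (G0 (Ui v)))"

lemma U_Ui: "U (Ui v) = v"
  by (simp add: U_def Ui_def S_R)

lemma Ui_U: "y \<in> Yspace DS \<Longrightarrow> Ui (U y) = y"
  by (simp add: U_def Ui_def R_S Yspace_def)

lemma Ui_Y: "Ui v \<in> Yspace DS"
  by (simp add: Ui_def Yspace_def R_DS)

lemma Ui_add: "Ui (v + w) = Ui v + Ui w" and Ui_psmul: "Ui (psmul smul k v) = psmul smul k (Ui v)"
  by (simp_all add: Ui_def psmul_def R_add R_scale)

lemma Y_subspace: "subspace_on (psmul smul) (Yspace DS)"
  by (auto simp: subspace_on_def Yspace_def psmul_def S.D_zero S.D_add S.D_scale)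

lemma Y_diff: "x \<in> Yspace DS \<Longrightarrow> y \<in> Yspace DS \<Longrightarrow> x - y \<in> Yspace DS"
  and Y_psmul: "x \<in> Yspace DS \<Longrightarrow> psmul smul k x \<in> Yspace DS"
  by (auto simp: Yspace_def psmul_def S.D_diff S.D_add S.D_scale)

lemma U_add: "x \<in> Yspace DS \<Longrightarrow> y \<in> Yspace DS \<Longrightarrow> U (x + y) = U x + U y"
  and U_diff: "x \<in> Yspace DS \<Longrightarrow> y \<in> Yspace DS \<Longrightarrow> U (x - y) = U x - U y"
  and U_psmul: "x \<in> Yspace DS \<Longrightarrow> U (psmul smul k x) = psmul smul k (U x)"
  by (simp_all add: U_def Yspace_def psmul_def S.G_add S.G_diff S.G_scale)

lemma DH_Y: "x \<in> DH DA DS \<Longrightarrow> x \<in> Yspace DS"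
  by (auto simp: DH_def Yspace_def DA_iff)

lemma Ui_DH_iff: "Ui v \<in> DH DA DS \<longleftrightarrow> v \<in> DW"
  by (simp add: Ui_def DH_def DW_def R_DA_iff)

lemma U_DW_iff: "y \<in> Yspace DS \<Longrightarrow> U y \<in> DW \<longleftrightarrow> y \<in> DH DA DS"
  using Ui_DH_iff[of "U y"] by (simp add: Ui_U)

lemma G0_Y: "x \<in> DH DA DS \<Longrightarrow> psmul smul s (G0 x) \<in> Yspace DS"
  by (auto simp: DH_def Yspace_def psmul_def G0_eq S.D_scale S.D_minus)

lemma GW_U: "y \<in> Yspace DS \<Longrightarrow> GW s (U y) = U (psmul smul s (G0 y))"
  by (simp add: GW_def Ui_U)

lemma yip_U: "yip ip S x y = prod_ip ip (U x) (U y)"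
  by (simp add: yip_def prod_ip_def U_def)

lemma ynorm_U: "ynorm ip S y = hnorm (prod_ip ip) (U y)"
  by (simp add: ynorm_def hnorm_def yip_U)

sublocale W: chilbert "psmul smul" "prod_ip ip"
  by unfold_locales (rule prod_hilbert)

lemma DW_dense: "dense_in (prod_ip ip) DW"
  unfolding dense_in_def
proof (intro allI impI)
  fix x :: "'a \<times> 'a" and e :: real assume e: "e > 0"
  have DS_dense: "dense_in ip DS" using S_sa unfolding self_adjoint_def by blast
  have e2: "e / 2 > 0" using e by simp
  obtain u where u: "u \<in> DS" "nm (fst x - u) < e / 2" using DS_dense e2 unfolding dense_in_def by blast
  obtain v where v: "v \<in> DS" "nm (snd x - v) < e / 2" using DS_dense e2 unfolding dense_in_def by blast
  have "hnorm (prod_ip ip) (x - (u, v)) < e" using hnorm_prod_le[of "x - (u, v)"] u v by simp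
  then show "\<exists>y\<in>DW. hnorm (prod_ip ip) (x - y) < e" using u v by (intro bexI[of _ "(u, v)"]) (auto simp: DW_def)
qed

lemma G0_lin:
  assumes "x \<in> DH DA DS" "y \<in> DH DA DS"
  shows "G0 (x + y) = G0 x + G0 y" "G0 (psmul smul k x) = psmul smul k (G0 x)"
  using assms by (auto simp: G0_eq psmul_def DH_def DA_iff A.G_add B.G_add C.G_add A.G_scale B.G_scale C.G_scale
      scale_right_distrib mult.commute)

lemma GW_lin: "lin_on (psmul smul) (psmul smul) DW (GW s)"
  unfolding lin_on_def
proof (intro conjI ballI allI)
  show "subspace_on (psmul smul) DW"
    by (auto simp: subspace_on_def DW_def psmul_def S.D_zero S.D_add S.D_scale)
  fix x assume "x \<in> DW"
  then have x: "Ui x \<in> DH DA DS" by (simp add: Ui_DH_iff)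
  show "GW s (psmul smul k x) = psmul smul k (GW s x)" for k
    using G0_Y[OF x, of s] by (simp add: GW_def Ui_psmul G0_lin(2)[OF x x] U_psmul[symmetric] mult.commute)
  fix y assume "y \<in> DW"
  then have y: "Ui y \<in> DH DA DS" by (simp add: Ui_DH_iff)
  show "GW s (x + y) = GW s x + GW s y"
    using G0_Y[OF x, of s] G0_Y[OF y, of s]
    by (simp add: GW_def Ui_add G0_lin(1)[OF x y] U_add[symmetric] W.scale_right_distrib)
qed

lemma GW_quasi_maccretive:
  assumes s: "s = 1 \<or> s = (-1 :: complex)"
  shows "\<exists>\<mu>. quasi_maccretive (psmul smul) (prod_ip ip) DW (GW s) \<mu> L0"
proof -
  obtain \<mu> where \<mu>: "\<And>x. x \<in> DH DA DS \<Longrightarrow>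
      \<bar>Re (yip ip S x (G0 x))\<bar> \<le> \<mu> * ((nm (S (fst x)))\<^sup>2 + (nm (snd x))\<^sup>2)"
    using energy_bound by blast
  have "quasi_maccretive (psmul smul) (prod_ip ip) DW (GW s) \<mu> L0"
  proof
    show "lin_on (psmul smul) (psmul smul) DW (GW s)" by (rule GW_lin)
    show "dense_in (prod_ip ip) DW" by (rule DW_dense)
    show "- \<mu> * (hnorm (prod_ip ip) v)\<^sup>2 \<le> Re (prod_ip ip v (GW s v))" if "v \<in> DW" for v
    proof -
      have x: "Ui v \<in> DH DA DS" using that by (simp add: Ui_DH_iff)
      have "prod_ip ip v (GW s v) = prod_ip ip (U (Ui v)) (psmul smul s (U (G0 (Ui v))))"
        using G0_Y[OF x, of 1] by (simp add: GW_def U_Ui U_psmul)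
      also have "\<dots> = s * yip ip S (Ui v) (G0 (Ui v))"
        by (simp add: W.ip_scale_right yip_U)
      finally have "Re (prod_ip ip v (GW s v)) = Re s * Re (yip ip S (Ui v) (G0 (Ui v)))"
        using s by auto
      moreover have "(hnorm (prod_ip ip) v)\<^sup>2 = (nm (S (fst (Ui v))))\<^sup>2 + (nm (snd (Ui v)))\<^sup>2"
        by (simp add: hnorm_prod Ui_def S_R)
      ultimately show ?thesis using \<mu>[OF x] s by auto
    qed
    show "\<exists>v\<in>DW. psmul smul (complex_of_real r) v + GW s v = w" if r: "L0 < r" for r w
    proof -
      obtain \<xi> where \<xi>: "\<xi> \<in> DH DA DS" "psmul smul (of_real r) \<xi> + psmul smul s (G0 \<xi>) = Ui w"
        using range_large_energy[OF r s Ui_Y] by blast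
      have "psmul smul (of_real r) (U \<xi>) + GW s (U \<xi>) = U (Ui w)"
        using DH_Y[OF \<xi>(1)] G0_Y[OF \<xi>(1), of s]
        by (simp only: \<xi>(2)[symmetric] U_add U_psmul GW_U Y_psmul)
      moreover have "U \<xi> \<in> DW" using \<xi>(1) U_DW_iff DH_Y by blast
      ultimately show ?thesis unfolding U_Ui by blast
    qed
  qed
  then show ?thesis by blast
qed

text \<open>The quantifier over \<mu> stands inside the one over T: the semigroup is fixed once,
  with a shift from the energy estimate, and then tested against each admissible \<mu>.\<close>

lemma generation:
  assumes s: "s = 1 \<or> s = (-1 :: complex)" and G: "\<And>y. G y = psmul smul s (G0 y)"
  shows "\<exists>T. sc_semigroup smul ip DS S T \<and> is_generator smul ip DS S T (DH DA DS) G \<and>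
    (\<forall>\<mu>::real. (\<forall>x\<in>DH DA DS. Re (yip ip S x (G x)) \<ge> - \<mu> * Re (yip ip S x x)) \<longrightarrow>
        op_spectrum smul ip DS S (DH DA DS) G \<subseteq> {z. Re z \<ge> - \<mu>} \<and>
        (\<forall>t\<ge>0. \<forall>y\<in>Yspace DS. ynorm ip S (T t y) \<le> exp (\<mu> * t) * ynorm ip S y))"
proof -
  obtain \<mu>0 where "quasi_maccretive (psmul smul) (prod_ip ip) DW (GW s) \<mu>0 L0"
    using GW_quasi_maccretive[OF s] by blast
  then interpret Q: quasi_maccretive "psmul smul" "prod_ip ip" DW "GW s" \<mu>0 L0 .
  define T where "T t y = Ui (Q.semi t (U y))" for t y
  have TY: "T t y \<in> Yspace DS" for t y by (simp add: T_def Ui_Y)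
  have UT: "U (T t y) = Q.semi t (U y)" for t y by (simp add: T_def U_Ui)
  have GY: "G x \<in> Yspace DS" if "x \<in> DH DA DS" for x using G0_Y[OF that] by (simp add: G)
  have UG: "U (G x) = GW s (U x)" if "x \<in> DH DA DS" for x
    using GW_U[OF DH_Y[OF that]] by (simp add: G)
  have semi_lin: "Q.semi t (x + y) = Q.semi t x + Q.semi t y"
    "Q.semi t (psmul smul k x) = psmul smul k (Q.semi t x)" if "t \<ge> 0" for t x y k
    using Q.semi_lin[OF that] unfolding lin_on_def by blast+
  have bound: "ynorm ip S (T t y) \<le> exp (\<nu> * t) * ynorm ip S y"
    if "\<And>v. v \<in> DW \<Longrightarrow> Re (prod_ip ip v (GW s v)) \<ge> - \<nu> * (hnorm (prod_ip ip) v)\<^sup>2" "t \<ge> 0" for t y \<nu>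
    using Q.semi_nm_le[OF that] by (simp add: ynorm_U UT)
  have sc: "sc_semigroup smul ip DS S T"
    unfolding sc_semigroup_def
  proof (intro conjI allI impI ballI)
    fix t :: real assume t: "t \<ge> 0"
    show "lin_on (psmul smul) (psmul smul) (Yspace DS) (T t)"
      unfolding lin_on_def using Y_subspace t
      by (auto simp: T_def U_add U_psmul semi_lin Ui_add Ui_psmul)
    show "\<exists>K. \<forall>y\<in>Yspace DS. ynorm ip S (T t y) \<le> K * ynorm ip S y"
      using bound[OF Q.quasi_accretive t] by blast
    fix y assume y: "y \<in> Yspace DS"
    show "T t y \<in> Yspace DS" by (rule TY)
    show "T (r + t) y = T r (T t y)" if "r \<ge> 0" for r
      using Q.semi_plus[OF that t] by (simp add: T_def U_Ui)
    show "((\<lambda>r. ynorm ip S (T r y - T t y)) \<longlongrightarrow> 0) (at t within {0..})"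
      using Q.semi_continuous[OF t, of "U y"] by (simp add: W.tends_def ynorm_U U_diff TY UT)
  next
    fix y assume "y \<in> Yspace DS"
    then show "T 0 y = y" by (simp add: T_def Q.semi_zero Ui_U)
  qed
  have quot: "U (psmul smul k (T h y - y)) = psmul smul k (Q.semi h (U y) - U y)"
    if "y \<in> Yspace DS" for k h y
    using that by (simp add: U_psmul Y_diff TY U_diff UT)
  have quotY: "psmul smul k (T h y - y) \<in> Yspace DS" if "y \<in> Yspace DS" for k h y
    using that by (simp add: Y_psmul Y_diff TY)
  have der: "((\<lambda>h. ynorm ip S (psmul smul (complex_of_real (1 / h)) (T h y - y) + G y)) \<longlongrightarrow> 0) (at_right 0)"
    if y: "y \<in> DH DA DS" for y
  proof -
    have "U y \<in> DW" using y U_DW_iff DH_Y by blast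
    from Q.semi_derivative[OF this]
    show ?thesis
      using y DH_Y by (simp add: W.tends_def ynorm_U U_add quotY GY quot UG del: of_real_divide)
  qed
  have gen: "is_generator smul ip DS S T (DH DA DS) G"
    unfolding is_generator_def
  proof (intro conjI ballI)
    show "DH DA DS \<subseteq> Yspace DS" using DH_Y by blast
  next
    fix y assume y: "y \<in> Yspace DS"
    show "y \<in> DH DA DS \<longleftrightarrow> (\<exists>z\<in>Yspace DS.
        ((\<lambda>h. ynorm ip S (psmul smul (complex_of_real (1 / h)) (T h y - y) - z)) \<longlongrightarrow> 0) (at_right 0))"
    proof
      assume yD: "y \<in> DH DA DS"
      have "- G y \<in> Yspace DS" using GY[OF yD] by (simp add: Yspace_def S.D_minus)
      then show "\<exists>z\<in>Yspace DS.
        ((\<lambda>h. ynorm ip S (psmul smul (complex_of_real (1 / h)) (T h y - y) - z)) \<longlongrightarrow> 0) (at_right 0)"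
        using der[OF yD] by (intro bexI[of _ "- G y"]) simp_all
    next
      assume "\<exists>z\<in>Yspace DS.
        ((\<lambda>h. ynorm ip S (psmul smul (complex_of_real (1 / h)) (T h y - y) - z)) \<longlongrightarrow> 0) (at_right 0)"
      then obtain z where z: "z \<in> Yspace DS"
        "((\<lambda>h. ynorm ip S (psmul smul (complex_of_real (1 / h)) (T h y - y) - z)) \<longlongrightarrow> 0) (at_right 0)"
        by blast
      have "W.tends (\<lambda>h. psmul smul (complex_of_real (1 / h)) (Q.semi h (U y) - U y)) (U z) (at_right 0)"
        using z(2) unfolding W.tends_def
        by (simp only: ynorm_U U_diff[OF quotY[OF y] z(1)] quot[OF y])
      then show "y \<in> DH DA DS" using Q.semi_derivative_domain U_DW_iff[OF y] by blast
    qed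
  next
    fix y assume y: "y \<in> DH DA DS"
    show "G y \<in> Yspace DS" by (rule GY[OF y])
    show "((\<lambda>h. ynorm ip S (psmul smul (complex_of_real (1 / h)) (T h y - y) + G y)) \<longlongrightarrow> 0) (at_right 0)"
      by (rule der[OF y])
  qed
  have "op_spectrum smul ip DS S (DH DA DS) G \<subseteq> {z. Re z \<ge> - \<mu>} \<and>
        (\<forall>t\<ge>0. \<forall>y\<in>Yspace DS. ynorm ip S (T t y) \<le> exp (\<mu> * t) * ynorm ip S y)"
    if low: "\<forall>x\<in>DH DA DS. Re (yip ip S x (G x)) \<ge> - \<mu> * Re (yip ip S x x)" for \<mu>
  proof
    have lowW: "- \<mu> * (hnorm (prod_ip ip) v)\<^sup>2 \<le> Re (prod_ip ip v (GW s v))" if "v \<in> DW" for v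
    proof -
      have x: "Ui v \<in> DH DA DS" using that by (simp add: Ui_DH_iff)
      then show ?thesis using low[rule_format, OF x] by (simp add: yip_U UG U_Ui W.nm_square)
    qed
    show "\<forall>t\<ge>0. \<forall>y\<in>Yspace DS. ynorm ip S (T t y) \<le> exp (\<mu> * t) * ynorm ip S y"
      using bound[OF lowW] by blast
    have "in_resolvent smul ip DS S (DH DA DS) G z" if z: "Re z < - \<mu>" for z
    proof -
      \<comment> \<open>z - G is the negative of (-z) + G, so the shift results apply at the point
        -z, whose real part exceeds \<mu> by \<open>k\<close>; the resolvent norm is then at most 1
        / k.\<close>
      define k where "k = - Re z - \<mu>"
      have k: "k > 0" using z by (simp add: k_def)
      have Ueq: "U (psmul smul z x - G x) = psmul smul z (U x) - GW s (U x)" if "x \<in> DH DA DS" for x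
        using DH_Y[OF that] GY[OF that] UG[OF that] by (simp add: U_diff Y_psmul U_psmul)
      have lowY: "k * ynorm ip S x \<le> ynorm ip S (psmul smul z x - G x)" if x: "x \<in> DH DA DS" for x
      proof -
        have "U x \<in> DW" using x U_DW_iff DH_Y by blast
        then have "k * hnorm (prod_ip ip) (U x) \<le> hnorm (prod_ip ip) (psmul smul (- z) (U x) + GW s (U x))"
          using Q.shift_lower_bound[OF lowW, of "U x" "- z"] by (simp add: k_def)
        also have "psmul smul (- z) (U x) + GW s (U x) = - U (psmul smul z x - G x)"
          by (simp add: Ueq[OF x])
        finally show ?thesis by (simp only: ynorm_U W.nm_minus)
      qed
      have "\<exists>!x. x \<in> DH DA DS \<and> psmul smul z x - G x = w" if w: "w \<in> Yspace DS" for w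
      proof (rule ex_ex1I)
        obtain v where v: "v \<in> DW" "psmul smul (- z) v + GW s v = - U w"
          using Q.shift_surj[OF lowW, of "- z" "- U w"] z by auto
        have x: "Ui v \<in> DH DA DS" using v by (simp add: Ui_DH_iff)
        have "- U (psmul smul z (Ui v) - G (Ui v)) = psmul smul (- z) v + GW s v"
          by (simp add: Ueq[OF x] U_Ui)
        then have "U (psmul smul z (Ui v) - G (Ui v)) = U w" using v by simp
        moreover have "psmul smul z (Ui v) - G (Ui v) \<in> Yspace DS"
          by (intro Y_diff Y_psmul Ui_Y GY x)
        ultimately have "psmul smul z (Ui v) - G (Ui v) = w" using w by (metis Ui_U)
        then show "\<exists>x. x \<in> DH DA DS \<and> psmul smul z x - G x = w" using x by blast
      next
        fix x y
        assume x: "x \<in> DH DA DS \<and> psmul smul z x - G x = w" and y: "y \<in> DH DA DS \<and> psmul smul z y - G y = w"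
        define e where "e = x - y"
        have e: "e \<in> DH DA DS" using x y by (auto simp: e_def DH_def A.D_diff S.D_diff)
        have G0e: "G0 x = G0 e + G0 y" using G0_lin(1)[OF e, of y] y by (simp add: e_def)
        have "psmul smul z e - G e = (psmul smul z x - G x) - (psmul smul z y - G y)"
          by (simp add: G G0e W.scale_right_distrib) (simp add: e_def W.scale_right_diff_distrib)
        then have "psmul smul z e - G e = 0" using x y by simp
        then have "k * ynorm ip S e \<le> 0" using lowY[OF e] by (simp add: ynorm_def yip_def S.G_zero)
        then have "hnorm (prod_ip ip) (U e) = 0"
          using k W.nm_nonneg[of "U e"] by (simp add: ynorm_U mult_le_0_iff)
        then have "U e = 0" by simp
        then have "U e = U 0" by (simp add: U_def S.G_zero prod_eq_iff)
        then have "e = 0" using Ui_U[OF DH_Y[OF e]] Ui_U[of 0] by (simp add: Yspace_def S.D_zero)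
        then show "x = y" by (simp add: e_def)
      qed
      moreover have "\<forall>x\<in>DH DA DS. ynorm ip S x \<le> (1 / k) * ynorm ip S (psmul smul z x - G x)"
        using lowY k by (simp add: pos_le_divide_eq mult.commute)
      ultimately show ?thesis unfolding in_resolvent_def by blast
    qed
    then show "op_spectrum smul ip DS S (DH DA DS) G \<subseteq> {z. Re z \<ge> - \<mu>}"
      unfolding op_spectrum_def by force
  qed
  then show ?thesis using sc gen by blast
qed

end

theorem theorem7:
  fixes smul :: "complex \<Rightarrow> 'a::ab_group_add \<Rightarrow> 'a"
    and ip :: "'a \<Rightarrow> 'a \<Rightarrow> complex"
    and DA DS :: "'a set"
    and A S B C :: "'a \<Rightarrow> 'a"
    and \<epsilon> a b c d :: real
  assumes hilb: "complex_hilbert smul ip"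
    and nontriv: "\<exists>x::'a. x \<noteq> 0"
    and A_sa: "self_adjoint smul ip DA A"
    and eps: "\<epsilon> > 0" and A_pos: "\<forall>x\<in>DA. Re (ip x (A x)) \<ge> \<epsilon> * Re (ip x x)"
    and S_sqrt: "pos_sqrt smul ip DA A DS S"
    and B_lin: "lin_on smul smul DS B"
    and B_bd: "\<forall>x\<in>DS. (hnorm ip (B x))\<^sup>2 \<le> a\<^sup>2 * (hnorm ip (S x))\<^sup>2 + b\<^sup>2 * (hnorm ip x)\<^sup>2"
    and a_rng: "0 \<le> a" "a < 1"
    and B_sym_or_bdd: "(\<forall>x\<in>DS. \<forall>y\<in>DS. ip (B x) y = ip x (B y)) \<or>
                       (\<exists>K. \<forall>x\<in>DS. hnorm ip (B x) \<le> K * hnorm ip x)"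
    and C_lin: "lin_on smul smul DS C"
    and C_bd: "\<forall>x\<in>DS. (hnorm ip (C x))\<^sup>2 \<le> c\<^sup>2 * (hnorm ip (S x))\<^sup>2 + d\<^sup>2 * (hnorm ip x)\<^sup>2"
  shows "\<exists>Tp Tm.
     sc_semigroup smul ip DS S Tp \<and>
     is_generator smul ip DS S Tp (DH DA DS) (Gplus smul A B C) \<and>
     sc_semigroup smul ip DS S Tm \<and>
     is_generator smul ip DS S Tm (DH DA DS) (Gminus smul A B C) \<and>
     (\<forall>\<mu>::real. (\<forall>x\<in>DH DA DS. Re (yip ip S x (Gplus smul A B C x)) \<ge> - \<mu> * Re (yip ip S x x)) \<longrightarrow>
        op_spectrum smul ip DS S (DH DA DS) (Gplus smul A B C) \<subseteq> {z. Re z \<ge> - \<mu>} \<and>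
        (\<forall>t\<ge>0. \<forall>y\<in>Yspace DS. ynorm ip S (Tp t y) \<le> exp (\<mu> * t) * ynorm ip S y)) \<and>
     (\<forall>\<mu>::real. (\<forall>x\<in>DH DA DS. Re (yip ip S x (Gminus smul A B C x)) \<ge> - \<mu> * Re (yip ip S x x)) \<longrightarrow>
        op_spectrum smul ip DS S (DH DA DS) (Gminus smul A B C) \<subseteq> {z. Re z \<ge> - \<mu>} \<and>
        (\<forall>t\<ge>0. \<forall>y\<in>Yspace DS. ynorm ip S (Tm t y) \<le> exp (\<mu> * t) * ynorm ip S y))"
proof -
  interpret damped_wave smul ip DA DS A S B C \<epsilon> a b c d
    by unfold_locales (fact assms)+
  have p: "Gplus smul A B C y = psmul smul 1 (Gplus smul A B C y)" for y by simp
  \<comment> \<open>Reversing the sign of the generator is the case s = -1, so a single construction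
    yields both semigroups.\<close>
  have m: "Gminus smul A B C y = psmul smul (- 1) (Gplus smul A B C y)" for y
    by (simp add: Gplus_def Gminus_def)
  show ?thesis
    using generation[OF disjI1[OF refl] p] generation[OF disjI2[OF refl] m] by metis
qed

end
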